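(* Every reduced convex foliation of degree three on $\mathbb P^2_{\mathbb C}$ is linearly conjugate to the Fermat foliation $\mathcal F_3$ of degree three, described in an affine chart by the $1$-form $\overline{\omega}_3=(x^3-x)\mathrm dy-(y^3-y)\mathrm dx$.
   Context: A foliation $\mathcal F$ of degree $d$ on $\mathbb P^2_{\mathbb C}$ is given in homogeneous coordinates $[x:y:z]$, up to a nonzero scalar, by a $1$-form $\Omega=a\,\mathrm dx+b\,\mathrm dy+c\,\mathrm dz$ with $a,b,c$ homogeneous polynomials of degree $d+1$ without common factor satisfying $xa+yb+zc=0$. Equivalently it is given by a homogeneous vector field $Z$ on $\mathbb C^3$ with coefficients of degree $d$ without common factor, with $\Omega=i_{\mathrm R}i_Z(\mathrm dx\wedge\mathrm dy\wedge\mathrm dz)$, $\mathrm R=x\partial_x+y\partial_y+z\partial_z$. In the affine chart $z=1$ it is described by a polynomial $1$-form $A\,\mathrm dx+B\,\mathrm dy$ with $\gcd(A,B)=1$. Linearly conjugate means conjugate under $\mathrm{Aut}(\mathbb P^2_{\mathbb C})=\mathrm{PGL}_3(\mathbb C)$. The inflection divisor $\mathrm I_{\mathcal F}$ is the divisor of degree $3d$ given by the vanishing of the determinant of the $3\times3$ matrix with rows $(x,Z(x),Z^2(x))$, $(y,Z(y),Z^2(y))$, $(z,Z(z),Z^2(z))$. The foliation $\mathcal F$ is convex if $\mathrm I_{\mathcal F}$ is a product of $\mathcal F$-invariant lines. It is reduced convex if it is convex and $\mathrm I_{\mathcal F}$ is reduced; equivalently, if $\mathcal F$ has $3d$ distinct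 invariant lines, which is the maximal possible number in degree $d\ge1$. *)

theory Defs
  imports
    "HOL-Analysis.Determinants"
    "HOL-Computational_Algebra.Polynomial"
    "HOL-Computational_Algebra.Squarefree"
begin

text \<open>
  The ring \<open>\<complex>[x, y, z]\<close> is rendered as \<open>\<complex>[x][y][z]\<close>: the outermost polynomial variable is \<open>z\<close>,
  the innermost one is \<open>x\<close>.  The indices \<open>1, 2, 3\<close> of type \<open>3\<close> stand for \<open>x, y, z\<close>.
\<close>
type_synonym poly3 = "complex poly poly poly"

definition const3 :: "complex \<Rightarrow> poly3" where
  "const3 c = [:[:[:c:]:]:]"

definition coords :: "poly3 ^ 3" where
  "coords = vector [ [:[:[:0, 1:]:]:], [:[:0, 1:]:], [:0, 1:] ]"

definition pdiff :: "3 \<Rightarrow> poly3 \<Rightarrow> poly3" where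
  "pdiff i p =
     (if i = 1 then map_poly (map_poly pderiv) p
      else if i = 2 then map_poly pderiv p
      else pderiv p)"

definition homogeneous :: "nat \<Rightarrow> poly3 \<Rightarrow> bool" where
  "homogeneous n p \<longleftrightarrow> (\<forall>i j k. coeff (coeff (coeff p k) j) i \<noteq> 0 \<longrightarrow> i + j + k = n)"

text \<open>\<open>subst3 \<phi> p\<close> is the polynomial \<open>p(\<phi>\<^sub>1, \<phi>\<^sub>2, \<phi>\<^sub>3)\<close>.\<close>
definition subst3 :: "poly3 ^ 3 \<Rightarrow> poly3 \<Rightarrow> poly3" where
  "subst3 \<phi> p =
     poly (map_poly (\<lambda>q. poly (map_poly (\<lambda>r. poly (map_poly const3 r) (\<phi> $ 1)) q) (\<phi> $ 2)) p) (\<phi> $ 3)"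

text \<open>
  A vector \<open>\<Omega> :: poly3 ^ 3\<close> is read either as the 1-form \<open>\<Omega>\<^sub>1 dx + \<Omega>\<^sub>2 dy + \<Omega>\<^sub>3 dz\<close> or, in the role of
  \<open>Z\<close>, as the vector field \<open>Z\<^sub>1 \<partial>\<^sub>x + Z\<^sub>2 \<partial>\<^sub>y + Z\<^sub>3 \<partial>\<^sub>z\<close>.  The radial field is \<open>coords\<close>.
\<close>
definition no_common_factor :: "poly3 ^ 3 \<Rightarrow> bool" where
  "no_common_factor v \<longleftrightarrow> (\<forall>h. (\<forall>i. h dvd v $ i) \<longrightarrow> is_unit h)"

definition foliation_form :: "nat \<Rightarrow> poly3 ^ 3 \<Rightarrow> bool" where
  "foliation_form d \<Omega> \<longleftrightarrow>
     (\<forall>i. homogeneous (d + 1) (\<Omega> $ i)) \<and> no_common_factor \<Omega> \<and>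
     (\<Sum>i\<in>UNIV. coords $ i * \<Omega> $ i) = 0"

text \<open>The 1-form \<open>v \<mapsto> (dx \<and> dy \<and> dz)(Z, R, v)\<close>, that is \<open>i\<^sub>R i\<^sub>Z (dx \<and> dy \<and> dz)\<close>.\<close>
definition form_of_field :: "poly3 ^ 3 \<Rightarrow> poly3 ^ 3" where
  "form_of_field Z = (\<chi> j. det (vector [Z, coords, axis j 1] :: poly3 ^ 3 ^ 3))"

definition field_of_foliation :: "nat \<Rightarrow> poly3 ^ 3 \<Rightarrow> poly3 ^ 3 \<Rightarrow> bool" where
  "field_of_foliation d \<Omega> Z \<longleftrightarrow>
     (\<forall>i. homogeneous d (Z $ i)) \<and> no_common_factor Z \<and> \<Omega> = form_of_field Z"

definition derivation :: "poly3 ^ 3 \<Rightarrow> poly3 \<Rightarrow> poly3" where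
  "derivation Z f = (\<Sum>i\<in>UNIV. Z $ i * pdiff i f)"

definition inflection_poly :: "poly3 ^ 3 \<Rightarrow> poly3" where
  "inflection_poly Z =
     det (\<chi> i. vector [coords $ i, derivation Z (coords $ i),
                       derivation Z (derivation Z (coords $ i))] :: poly3 ^ 3 ^ 3)"

text \<open>The line \<open>l = 0\<close> is invariant iff \<open>l\<close> divides the 2-form \<open>dl \<and> \<Omega>\<close>.\<close>
definition invariant_line :: "poly3 ^ 3 \<Rightarrow> poly3 \<Rightarrow> bool" where
  "invariant_line \<Omega> l \<longleftrightarrow>
     homogeneous 1 l \<and> l \<noteq> 0 \<and>
     (\<forall>i j. l dvd pdiff i l * \<Omega> $ j - pdiff j l * \<Omega> $ i)"

definition product_of_invariant_lines :: "poly3 ^ 3 \<Rightarrow> poly3 \<Rightarrow> bool" where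
  "product_of_invariant_lines \<Omega> p \<longleftrightarrow>
     (\<exists>c ls. c \<noteq> 0 \<and> (\<forall>l\<in>set ls. invariant_line \<Omega> l) \<and> p = const3 c * prod_list ls)"

text \<open>
  A field \<open>Z\<close> with \<open>\<Omega> = i\<^sub>R i\<^sub>Z (dx \<and> dy \<and> dz)\<close> is unique up to adding \<open>g R\<close> with \<open>g\<close> homogeneous of
  degree \<open>d - 1\<close>, which leaves \<open>inflection_poly Z\<close> unchanged; so the choice of \<open>Z\<close> below is
  immaterial.  A divisor is reduced iff its equation is squarefree.
\<close>
definition convex_foliation :: "nat \<Rightarrow> poly3 ^ 3 \<Rightarrow> bool" where
  "convex_foliation d \<Omega> \<longleftrightarrow> foliation_form d \<Omega> \<and>
     (\<exists>Z. field_of_foliation d \<Omega> Z \<and> product_of_invariant_lines \<Omega> (inflection_poly Z))"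

definition reduced_convex_foliation :: "nat \<Rightarrow> poly3 ^ 3 \<Rightarrow> bool" where
  "reduced_convex_foliation d \<Omega> \<longleftrightarrow> convex_foliation d \<Omega> \<and>
     (\<exists>Z. field_of_foliation d \<Omega> Z \<and> squarefree (inflection_poly Z))"

definition linear_map :: "complex ^ 3 ^ 3 \<Rightarrow> poly3 ^ 3" where
  "linear_map A = (\<chi> i. \<Sum>j\<in>UNIV. const3 (A $ i $ j) * coords $ j)"

text \<open>\<open>\<phi>\<^sup>*\<Omega> = \<Sum>\<^sub>i (\<Omega>\<^sub>i \<circ> \<phi>) d\<phi>\<^sub>i\<close>\<close>
definition pullback :: "poly3 ^ 3 \<Rightarrow> poly3 ^ 3 \<Rightarrow> poly3 ^ 3" where
  "pullback \<phi> \<Omega> = (\<chi> j. \<Sum>i\<in>UNIV. subst3 \<phi> (\<Omega> $ i) * pdiff j (\<phi> $ i))"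

text \<open>
  An element of \<open>PGL\<^sub>3(\<complex>)\<close> is represented by an invertible matrix; the scalar \<open>c\<close> accounts for
  1-forms defining a foliation only up to a nonzero scalar.
\<close>
definition linearly_conjugate :: "poly3 ^ 3 \<Rightarrow> poly3 ^ 3 \<Rightarrow> bool" where
  "linearly_conjugate \<Omega> \<Omega>' \<longleftrightarrow>
     (\<exists>A c. invertible A \<and> c \<noteq> 0 \<and> (\<forall>j. pullback (linear_map A) \<Omega> $ j = const3 c * \<Omega>' $ j))"

text \<open>
  Restriction to the chart \<open>z = 1\<close>: since \<open>z\<close> is the outermost variable, evaluating at \<open>1\<close> gives a
  polynomial in \<open>\<complex>[x][y]\<close>, and \<open>dz\<close> becomes \<open>0\<close>.  The pair \<open>(A, B)\<close> is the 1-form \<open>A dx + B dy\<close>.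
\<close>
definition affine_form :: "poly3 ^ 3 \<Rightarrow> complex poly poly \<times> complex poly poly" where
  "affine_form \<Omega> = (poly (\<Omega> $ 1) 1, poly (\<Omega> $ 2) 1)"

definition fermat_affine_form :: "nat \<Rightarrow> complex poly poly \<times> complex poly poly" where
  "fermat_affine_form d =
     (let x = [:[:0, 1:]:]; y = [:0, 1:] in (- (y ^ d - y), x ^ d - x))"

text \<open>
  A homogeneous form of known degree with \<open>x a + y b + z c = 0\<close> is determined by its affine form, so
  for each \<open>d\<close> at most one form satisfies this.
\<close>
definition fermat_foliation :: "nat \<Rightarrow> poly3 ^ 3 \<Rightarrow> bool" where
  "fermat_foliation d \<Omega> \<longleftrightarrow> foliation_form d \<Omega> \<and> affine_form \<Omega> = fermat_affine_form d"

end

theory Submission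
  imports Defs "HOL-Computational_Algebra.Fundamental_Theorem_Algebra"
begin

text \<open>The nine inflection lines of a reduced convex foliation of degree three form the reflection arrangement
  \<open>B\<^sub>3\<close>, the lines \<open>x, y, z, x \<plusminus> y, y \<plusminus> z, z \<plusminus> x\<close> in suitable coordinates, and a foliation of degree three leaving
  this arrangement invariant is the Fermat foliation.

  The arrangement is determined from the local behaviour of the field at its singular points, the points \<open>p\<close> with
  \<open>Z p = \<mu> p\<close>.  As the inflection polynomial is squarefree, its order of vanishing at \<open>p\<close> is the number of
  lines through \<open>p\<close>.  Expanding the inflection determinant shows that this order is at least two at every singular
  point (\<open>card_lines_through_ge2\<close>), that it is never more than four (\<open>card_lines_through_le4\<close>), and that the linear
  part of the foliation at \<open>p\<close> is invertible (\<open>singular_nondegenerate\<close>).  So the binary quartic whose zeros are the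
  singular points on a given line has simple zeros: each of the nine lines contains exactly four singular points, and
  these are its intersection points with the eight other lines.  By an argument of Camacho-Sad type, they
  cannot all be points on three or more lines (\<open>double_on_line\<close>).

  Therefore the numbers of other lines through the four points of a line are \<open>3, 3, 1, 1\<close> or \<open>3, 2, 2, 1\<close>.  Double
  counting leaves three lines of the first kind, three points on four lines, and then a single incidence structure
  (\<open>B3_configuration\<close>).  Its realization is unique up to a linear change of coordinates (\<open>B3_normal_form\<close>):
  the four triple points force the remaining slopes to be \<open>-1\<close>.  Finally, the coefficients of a cubic
  field are computed from the invariance of the nine lines (\<open>fermat_coefficients\<close>).\<close>

section \<open>Vector algebra in complex three-space\<close>

text \<open>Bilinear, not Hermitian: it pairs the coefficient vector of a linear form with a point.\<close>
definition dotc :: "complex ^ 3 \<Rightarrow> complex ^ 3 \<Rightarrow> complex" where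
  "dotc u v = u $ 1 * v $ 1 + u $ 2 * v $ 2 + u $ 3 * v $ 3"

definition crossc :: "complex ^ 3 \<Rightarrow> complex ^ 3 \<Rightarrow> complex ^ 3" where
  "crossc u v = vector [u $ 2 * v $ 3 - u $ 3 * v $ 2, u $ 3 * v $ 1 - u $ 1 * v $ 3,
                        u $ 1 * v $ 2 - u $ 2 * v $ 1]"

definition det3 :: "complex ^ 3 \<Rightarrow> complex ^ 3 \<Rightarrow> complex ^ 3 \<Rightarrow> complex" where
  "det3 u v w = dotc u (crossc v w)"

lemma crossc_nth [simp]:
  "crossc u v $ 1 = u $ 2 * v $ 3 - u $ 3 * v $ 2"
  "crossc u v $ 2 = u $ 3 * v $ 1 - u $ 1 * v $ 3"
  "crossc u v $ 3 = u $ 1 * v $ 2 - u $ 2 * v $ 1"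
  by (simp_all add: crossc_def)

lemmas vec3_simps = det3_def dotc_def vec_eq_iff forall_3

lemma dotc_linear:
  "dotc l (u + v) = dotc l u + dotc l v" "dotc l (u - v) = dotc l u - dotc l v"
  "dotc l (s *s v) = s * dotc l v" "dotc l 0 = 0"
  "dotc (l + m) v = dotc l v + dotc m v" "dotc (l - m) v = dotc l v - dotc m v"
  "dotc (s *s l) v = s * dotc l v" "dotc 0 v = 0"
  by (simp_all add: dotc_def algebra_simps)

lemma crossc_linear:
  "crossc l (u + v) = crossc l u + crossc l v" "crossc l (u - v) = crossc l u - crossc l v"
  "crossc l (s *s v) = s *s crossc l v" "crossc l 0 = 0"
  "crossc (l + m) v = crossc l v + crossc m v" "crossc (l - m) v = crossc l v - crossc m v"
  "crossc (s *s l) v = s *s crossc l v" "crossc 0 v = 0" "crossc v v = 0"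
  by (simp_all add: vec3_simps algebra_simps)

lemma det3_linear:
  "det3 (u + u') v w = det3 u v w + det3 u' v w" "det3 (u - u') v w = det3 u v w - det3 u' v w"
  "det3 (s *s u) v w = s * det3 u v w" "det3 0 v w = 0"
  "det3 u (v + v') w = det3 u v w + det3 u v' w" "det3 u (v - v') w = det3 u v w - det3 u v' w"
  "det3 u (s *s v) w = s * det3 u v w" "det3 u 0 w = 0"
  "det3 u v (w + w') = det3 u v w + det3 u v w'" "det3 u v (w - w') = det3 u v w - det3 u v w'"
  "det3 u v (s *s w) = s * det3 u v w" "det3 u v 0 = 0"
  "det3 u u w = 0" "det3 u v u = 0" "det3 u v v = 0"
  by (simp_all add: vec3_simps algebra_simps)

lemma det3_rotate: "det3 u v w = det3 v w u"
  by (simp add: vec3_simps algebra_simps)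

lemma det3_swap: "det3 u v w = - det3 v u w"
  by (simp add: vec3_simps algebra_simps)

lemma dotc_commute: "dotc u v = dotc v u"
  by (simp add: dotc_def algebra_simps)

lemma crossc_anti: "crossc u v = - crossc v u"
  by (simp add: vec3_simps)

lemma dotc_crossc [simp]: "dotc u (crossc u v) = 0" "dotc v (crossc u v) = 0"
  by (simp_all add: vec3_simps algebra_simps)

lemma crossc_crossc: "crossc u (crossc v w) = dotc u w *s v - dotc u v *s w"
  by (simp add: vec3_simps algebra_simps)

lemma crossc_eq_0D:
  assumes "crossc u v = 0" "u \<noteq> 0"
  obtains s where "v = s *s u"
proof -
  have e: "u $ 2 * v $ 3 = u $ 3 * v $ 2" "u $ 3 * v $ 1 = u $ 1 * v $ 3" "u $ 1 * v $ 2 = u $ 2 * v $ 1"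
    using assms(1) by (auto simp: vec3_simps)
  consider "u $ 1 \<noteq> 0" | "u $ 2 \<noteq> 0" | "u $ 3 \<noteq> 0"
    using assms(2) by (auto simp: vec3_simps)
  then have "\<exists>s. v = s *s u"
  proof cases
    case 1
    then have "v = (v $ 1 / u $ 1) *s u" using e by (simp add: vec3_simps field_simps)
    then show ?thesis by blast
  next
    case 2
    then have "v = (v $ 2 / u $ 2) *s u" using e by (simp add: vec3_simps field_simps)
    then show ?thesis by blast
  next
    case 3
    then have "v = (v $ 3 / u $ 3) *s u" using e by (simp add: vec3_simps field_simps)
    then show ?thesis by blast
  qed
  then show thesis using that by blast
qed

lemma common_zero:
  assumes "crossc l m \<noteq> 0" "dotc l p = 0" "dotc m p = 0"
  obtains s where "p = s *s crossc l m"
proof -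
  have "crossc (crossc l m) p = 0"
    using assms crossc_crossc[of p l m] crossc_anti[of "crossc l m" p]
    by (simp add: dotc_commute[of p])
  then show thesis using assms(1) that by (elim crossc_eq_0D)
qed

lemma cramer:
  "det3 a b c *s v = det3 v b c *s a + det3 a v c *s b + det3 a b v *s c"
  by (simp add: vec3_simps algebra_simps)

lemma nonzero_dotc_ex: 
  assumes "u \<noteq> 0" shows "\<exists>v. dotc u v \<noteq> 0"
proof -
  have "dotc u (axis i 1) = u $ i" for i using exhaust_3[of i] by (auto simp: dotc_def axis_def)
  then show ?thesis using assms by (metis vec_eq_iff zero_index)
qed

lemma in_span_of_det3_zero:
  assumes "crossc a b \<noteq> 0" "det3 a b v = 0"
  obtains s t where "v = s *s a + t *s b"
proof -
  obtain c where c: "dotc (crossc a b) c \<noteq> 0" using assms(1) nonzero_dotc_ex by blast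
  have d: "det3 a b c \<noteq> 0" using c by (simp add: vec3_simps algebra_simps)
  have "det3 a b c *s v = det3 v b c *s a + det3 a v c *s b"
    using cramer[of a b c v] assms(2) by simp
  then have "inverse (det3 a b c) *s (det3 a b c *s v) 
      = inverse (det3 a b c) *s (det3 v b c *s a + det3 a v c *s b)" by simp
  then have "v = (inverse (det3 a b c) * det3 v b c) *s a + (inverse (det3 a b c) * det3 a v c) *s b"
    using d by (simp add: vector_smult_assoc vector_add_ldistrib)
  then show thesis using that by blast
qed

text \<open>The moment curve \<open>s \<mapsto> (1, s, s\<^sup>2)\<close> meets each plane through the origin in at most two points, so it
  leaves any finite union of them.\<close>
lemma generic_vector:
  assumes "finite F" "0 \<notin> F"
  obtains v where "\<And>f. f \<in> F \<Longrightarrow> dotc f v \<noteq> 0"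
proof -
  let ?p = "\<lambda>f::complex^3. [:f $ 1, f $ 2, f $ 3:]"
  have nz: "?p f \<noteq> 0" if "f \<in> F" for f
  proof
    assume "?p f = 0"
    then have "f = 0" by (auto simp: vec3_simps)
    then show False using that assms(2) by simp
  qed
  have "finite (\<Union>f\<in>F. {s. poly (?p f) s = 0})"
    using assms(1) nz by (intro finite_UN_I poly_roots_finite) auto
  then obtain s where s: "s \<notin> (\<Union>f\<in>F. {s. poly (?p f) s = 0})"
    using ex_new_if_finite[OF infinite_UNIV_char_0[where 'a = complex]] by blast
  have "dotc f (vector [1, s, s\<^sup>2]) = poly (?p f) s" for f
    by (simp add: dotc_def power2_eq_square algebra_simps)
  then show thesis using s by (intro that[of "vector [1, s, s\<^sup>2]"]) auto
qed

section \<open>Cubic vector fields and their inflection determinant\<close>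

lemma tendsto_smult3 [tendsto_intros]:
  fixes f :: "'b \<Rightarrow> complex" and g :: "'b \<Rightarrow> complex ^ 3"
  assumes "(f \<longlongrightarrow> a) F" "(g \<longlongrightarrow> b) F"
  shows "((\<lambda>t. f t *s g t) \<longlongrightarrow> a *s b) F"
  by (intro vec_tendstoI) (auto intro!: tendsto_intros assms)

lemma tendsto_dotc [tendsto_intros]:
  fixes f :: "'b \<Rightarrow> complex ^ 3"
  assumes "(f \<longlongrightarrow> a) F" "(g \<longlongrightarrow> b) F"
  shows "((\<lambda>t. dotc (f t) (g t)) \<longlongrightarrow> dotc a b) F"
  unfolding dotc_def by (intro tendsto_intros assms)

lemma tendsto_det3 [tendsto_intros]:
  fixes f :: "'b \<Rightarrow> complex ^ 3"
  assumes "(f \<longlongrightarrow> a) F" "(g \<longlongrightarrow> b) F" "(h \<longlongrightarrow> c) F"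
  shows "((\<lambda>t. det3 (f t) (g t) (h t)) \<longlongrightarrow> det3 a b c) F"
  unfolding det3_def dotc_def crossc_nth by (intro tendsto_intros assms)

lemma axis_expansion: "(v::complex^3) = v $ 1 *s axis 1 1 + v $ 2 *s axis 2 1 + v $ 3 *s axis 3 1"
  by (simp add: vec3_simps axis_def)

text \<open>A homogeneous cubic field \<open>Z\<close> is handled through its polarization \<open>T\<close>, the symmetric trilinear map with
  \<open>Z v = T v v v\<close>: the derivative is \<open>3 T v v w\<close>, and Taylor expansions along lines are multilinear algebra.\<close>
locale cubic_field =
  fixes T :: "complex ^ 3 \<Rightarrow> complex ^ 3 \<Rightarrow> complex ^ 3 \<Rightarrow> complex ^ 3"
  assumes T_commute: "T u v w = T v u w" "T u v w = T u w v"
    and T_add1: "T (u + u') v w = T u v w + T u' v w"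
    and T_scale1: "T (s *s u) v w = s *s T u v w"
begin

definition Z where "Z v = T v v v"
definition D where "D v w = 3 *s T v v w"
definition infl where "infl v = det3 v (Z v) (D v (Z v))"

lemma T_add:
  "T (u + u') v w = T u v w + T u' v w" "T u (v + v') w = T u v w + T u v' w"
  "T u v (w + w') = T u v w + T u v w'"
  using T_add1 T_commute by metis+

lemma T_scale:
  "T (s *s u) v w = s *s T u v w" "T u (s *s v) w = s *s T u v w" "T u v (s *s w) = s *s T u v w"
  using T_scale1 T_commute by metis+

lemma D_add: "D p (u + v) = D p u + D p v"
  by (simp add: D_def T_add vector_add_ldistrib)

lemma D_scale: "D p (s *s v) = s *s D p v"
  by (simp add: D_def T_scale vector_smult_assoc mult.commute)

lemma D_diff: "D p (u - v) = D p u - D p v"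
  using D_add[of p "u - v" v] by (simp add: algebra_simps)

lemma D_self: "D p p = 3 *s Z p"
  by (simp add: D_def Z_def)

lemma Z_scale: "Z (s *s v) = s ^ 3 *s Z v"
  by (simp add: Z_def T_scale vector_smult_assoc power3_eq_cube)

lemma tendsto_T [tendsto_intros]:
  fixes f :: "'b \<Rightarrow> complex ^ 3"
  assumes "(f \<longlongrightarrow> a) F" "(g \<longlongrightarrow> b) F" "(h \<longlongrightarrow> c) F"
  shows "((\<lambda>t. T (f t) (g t) (h t)) \<longlongrightarrow> T a b c) F"
proof -
  have e1: "T u v w = u $ 1 *s T (axis 1 1) v w + u $ 2 *s T (axis 2 1) v w + u $ 3 *s T (axis 3 1) v w" for u v w
    by (subst axis_expansion[of u]) (simp only: T_add T_scale)
  have e2: "T u v w = v $ 1 *s T u (axis 1 1) w + v $ 2 *s T u (axis 2 1) w + v $ 3 *s T u (axis 3 1) w" for u v w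
    by (subst axis_expansion[of v]) (simp only: T_add T_scale)
  have e3: "T u v w = w $ 1 *s T u v (axis 1 1) + w $ 2 *s T u v (axis 2 1) + w $ 3 *s T u v (axis 3 1)" for u v w
    by (subst axis_expansion[of w]) (simp only: T_add T_scale)
  have c1: "((\<lambda>t. T (f t) v w) \<longlongrightarrow> T a v w) F" for v w
    unfolding e1[of "f _"] e1[of a] by (intro tendsto_intros assms)
  have c2: "((\<lambda>t. T (f t) (g t) w) \<longlongrightarrow> T a b w) F" for w
    unfolding e2[of _ "g _"] e2[of _ b] by (intro tendsto_intros assms c1)
  show ?thesis
    unfolding e3[of _ _ "h _"] e3[of _ _ c] by (intro tendsto_intros assms c2)
qed

lemma tendsto_D [tendsto_intros]:
  fixes f :: "'b \<Rightarrow> complex ^ 3"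
  assumes "(f \<longlongrightarrow> a) F" "(g \<longlongrightarrow> b) F"
  shows "((\<lambda>t. D (f t) (g t)) \<longlongrightarrow> D a b) F"
  unfolding D_def by (intro tendsto_intros assms)

lemma Z_line: "Z (p + t *s v) = Z p + t *s D p v + t\<^sup>2 *s D v p + t ^ 3 *s Z v"
  by (simp add: Z_def D_def T_add T_scale T_commute vec_eq_iff algebra_simps power2_eq_square power3_eq_cube)

text \<open>Adding a multiple of the radial field to \<open>Z\<close> is a column operation, because \<open>D q q = 3 Z q\<close>.  Only the
  value \<open>g\<close> of the multiplier at \<open>q\<close> matters, so it can be chosen separately at every point.\<close>
lemma infl_shift: "infl q = det3 q (Z q - g *s q) (D q (Z q - g *s q))"
  by (simp add: infl_def D_diff D_scale D_self det3_linear)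

definition singular where "singular p \<mu> \<longleftrightarrow> p \<noteq> 0 \<and> Z p = \<mu> *s p"

text \<open>At a singular point \<open>p\<close> of the foliation, where \<open>Z p = \<mu> p\<close>, this is up to multiples of \<open>p\<close> the linear
  part of \<open>Z - g R\<close>, \<open>R\<close> the radial field and \<open>g\<close> a quadratic form with \<open>g p = \<mu>\<close>.  Modulo \<open>p\<close> it is the linear part
  of the affine vector field at the corresponding point of the plane.\<close>
definition linear_part where "linear_part p \<mu> v = D p v - \<mu> *s v"

lemma linear_part_linear: "linear_part p \<mu> (u + v) = linear_part p \<mu> u + linear_part p \<mu> v" "linear_part p \<mu> (s *s v) = s *s linear_part p \<mu> v"
   "linear_part p \<mu> (u - v) = linear_part p \<mu> u - linear_part p \<mu> v"
  by (simp_all add: linear_part_def D_add D_scale D_diff vec_eq_iff algebra_simps)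

lemma linear_part_self: "singular p \<mu> \<Longrightarrow> linear_part p \<mu> p = (2 * \<mu>) *s p"
  by (simp add: linear_part_def D_self singular_def vec_eq_iff algebra_simps)

text \<open>\<open>Z - \<mu> R\<close> vanishes at \<open>p\<close>, so two columns of the inflection determinant are divisible by \<open>t\<close>.  The leading
  coefficient vanishes for every \<open>v\<close> exactly when the linear part is scalar or degenerate modulo \<open>p\<close>.\<close>
lemma infl_order2:
  assumes "singular p \<mu>"
  obtains G where "\<And>t. infl (p + t *s v) = t ^ 2 * G t"
    "(G \<longlongrightarrow> det3 p (linear_part p \<mu> v) (linear_part p \<mu> (linear_part p \<mu> v))) (at 0)"
proof -
  define A where "A t = linear_part p \<mu> v + t *s D v p + t\<^sup>2 *s Z v" for t
  define G where "G t = det3 (p + t *s v) (A t) (D (p + t *s v) (A t))" for t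
  have "Z (p + t *s v) - \<mu> *s (p + t *s v) = t *s A t" for t
    using assms by (simp add: Z_line singular_def A_def linear_part_def vec_eq_iff algebra_simps power2_eq_square power3_eq_cube)
  then have 1: "infl (p + t *s v) = t ^ 2 * G t" for t
    by (simp add: infl_shift[of _ \<mu>] G_def D_scale det3_linear power2_eq_square)
  have "(A \<longlongrightarrow> linear_part p \<mu> v + 0 *s D v p + 0\<^sup>2 *s Z v) (at 0)"
    unfolding A_def by (intro tendsto_intros)
  then have A: "(A \<longlongrightarrow> linear_part p \<mu> v) (at 0)" by simp
  have "(G \<longlongrightarrow> det3 (p + 0 *s v) (linear_part p \<mu> v) (D (p + 0 *s v) (linear_part p \<mu> v))) (at 0)"
    unfolding G_def by (intro tendsto_intros A)
  moreover have "det3 p (linear_part p \<mu> v) (D p (linear_part p \<mu> v)) = det3 p (linear_part p \<mu> v) (linear_part p \<mu> (linear_part p \<mu> v))"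
    by (simp add: linear_part_def[of _ _ "linear_part p \<mu> v"] det3_linear)
  ultimately show thesis using that[OF 1] by simp
qed

text \<open>If the linear part vanishes modulo \<open>p\<close>, the field can be taken of order two at \<open>p\<close>; its derivative
  has order one, and the orders of the columns add up to \<open>0 + 2 + 3\<close>.\<close>
lemma infl_order5:
  assumes "singular p \<mu>" "\<And>v. \<exists>s. linear_part p \<mu> v = s *s p"
  obtains G g where "\<And>t. infl (p + t *s v) = t ^ 5 * G t" "(G \<longlongrightarrow> g) (at 0)"
proof -
  have "p \<noteq> 0" using assms(1) by (simp add: singular_def)
  then obtain f where f: "dotc p f \<noteq> 0" using nonzero_dotc_ex by blast
  define \<xi> where "\<xi> v = dotc f (linear_part p \<mu> v) / dotc f p" for v
  have \<xi>: "linear_part p \<mu> v = \<xi> v *s p" for v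
  proof -
    obtain s where "linear_part p \<mu> v = s *s p" using assms(2) by blast
    then show ?thesis using f by (simp add: \<xi>_def dotc_linear dotc_commute[of f])
  qed
  define A where "A t = D v p - \<xi> v *s v + t *s Z v" for t
  have "Z (p + t *s v) - (\<mu> + t * \<xi> v) *s (p + t *s v) = t\<^sup>2 *s A t" for t
  proof -
    have "D p v = \<mu> *s v + \<xi> v *s p" using \<xi>[of v] by (simp add: linear_part_def algebra_simps)
    then show ?thesis using assms
    by (simp add: Z_line singular_def A_def vec_eq_iff algebra_simps power2_eq_square power3_eq_cube)
  qed
  then have 1: "infl (p + t *s v) = t ^ 4 * det3 (p + t *s v) (A t) (D (p + t *s v) (A t))" for t
    by (simp add: infl_shift[of _ "\<mu> + t * \<xi> v"] D_scale det3_linear power2_eq_square power4_eq_xxxx)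
  define G where "G t = det3 (p + t *s v) (A t) (6 *s T p v (A t) + t *s D v (A t)) -
      \<xi> (A t) * det3 (p + t *s v) (A t) v" for t
  have "det3 (p + t *s v) (A t) (D (p + t *s v) (A t)) = t * G t" for t
  proof -
    have "D (p + t *s v) w = D p w + t *s (6 *s T p v w + t *s D v w)" for w
      by (simp add: D_def T_add T_scale T_commute vec_eq_iff algebra_simps)
    moreover have "D p (A t) = \<mu> *s A t + \<xi> (A t) *s p"
      using \<xi>[of "A t"] by (simp add: linear_part_def algebra_simps)
    moreover have "det3 (p + t *s v) (A t) p = - t * det3 (p + t *s v) (A t) v"
      by (simp add: det3_linear) (simp add: vec3_simps algebra_simps)
    ultimately show ?thesis
      by (simp add: G_def det3_linear(9,10,11,12,14,15) algebra_simps)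
  qed
  with 1 have 2: "infl (p + t *s v) = t ^ 5 * G t" for t
    by (simp add: eval_nat_numeral)
  define A0 where "A0 = D v p - \<xi> v *s v + 0 *s Z v"
  have A: "(A \<longlongrightarrow> A0) (at 0)"
    unfolding A_def A0_def by (intro tendsto_intros)
  have "((\<lambda>t. \<xi> (A t)) \<longlongrightarrow> \<xi> A0) (at 0)"
    unfolding \<xi>_def linear_part_def using f by (intro tendsto_intros A) (simp add: dotc_commute)
  then have "(G \<longlongrightarrow> det3 (p + 0 *s v) A0 (6 *s T p v A0 + 0 *s D v A0) -
      \<xi> A0 * det3 (p + 0 *s v) A0 v) (at 0)"
    unfolding G_def by (intro tendsto_intros A)
  with 2 that show thesis by blast
qed


text \<open>The cubic polynomial \<open>t \<mapsto> l (Z (p + t v))\<close> vanishes identically; this reads off its linear coefficient.\<close>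
lemma invariant_linear_part:
  assumes "\<And>v. dotc l v = 0 \<Longrightarrow> dotc l (Z v) = 0" "dotc l p = 0" "dotc l v = 0"
  shows "dotc l (D p v) = 0"
proof -
  have "dotc l (Z (p + t *s v)) = t * dotc l (D p v) + t\<^sup>2 * dotc l (D v p)" for t
    using assms by (simp add: Z_line dotc_linear)
  moreover have "dotc l (p + t *s v) = 0" for t
    using assms by (simp add: dotc_linear)
  ultimately have e: "t * dotc l (D p v) + t\<^sup>2 * dotc l (D v p) = 0" for t
    using assms(1) by metis
  show ?thesis using e[of 1] e[of "-1"] by simp
qed

lemma invariant_eigenvalue:
  assumes "\<And>v. dotc l v = 0 \<Longrightarrow> dotc l (Z v) = 0" "dotc l p = 0" "l \<noteq> 0"
  obtains \<kappa> where "\<And>v. dotc l (D p v) = \<kappa> * dotc l v"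
proof -
  obtain e where e: "dotc l e \<noteq> 0" using assms(3) nonzero_dotc_ex by blast
  have "dotc l (D p v) = dotc l (D p e) / dotc l e * dotc l v" for v
  proof -
    have "dotc l (v - (dotc l v / dotc l e) *s e) = 0" using e by (simp add: dotc_linear)
    then have "dotc l (D p (v - (dotc l v / dotc l e) *s e)) = 0"
      using invariant_linear_part assms by blast
    then show ?thesis by (simp add: D_diff D_scale dotc_linear)
  qed
  then show thesis using that by blast
qed

text \<open>Three concurrent invariant lines force the linear part at their common point to be scalar:
  an endomorphism of a two-dimensional space with three eigendirections is a homothety.\<close>
lemma three_lines_scalar:
  assumes inv: "\<And>v. dotc l v = 0 \<Longrightarrow> dotc l (Z v) = 0" "\<And>v. dotc m v = 0 \<Longrightarrow> dotc m (Z v) = 0"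
      "\<And>v. dotc n v = 0 \<Longrightarrow> dotc n (Z v) = 0"
    and p: "dotc l p = 0" "dotc m p = 0" "dotc n p = 0" "p \<noteq> 0"
    and np: "crossc l m \<noteq> 0" "crossc l n \<noteq> 0" "crossc m n \<noteq> 0"
  obtains \<kappa> where "\<And>v. dotc l (D p v) = \<kappa> * dotc l v" "\<And>v. \<exists>s. D p v = \<kappa> *s v + s *s p"
proof -
  have nz: "l \<noteq> 0" "m \<noteq> 0" "n \<noteq> 0" using np by (auto simp: crossc_linear)
  obtain a where a: "\<And>v. dotc l (D p v) = a * dotc l v" using invariant_eigenvalue[OF inv(1) p(1) nz(1)] by blast
  obtain b where b: "\<And>v. dotc m (D p v) = b * dotc m v" using invariant_eigenvalue[OF inv(2) p(2) nz(2)] by blast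
  obtain c where c: "\<And>v. dotc n (D p v) = c * dotc n v" using invariant_eigenvalue[OF inv(3) p(3) nz(3)] by blast
  obtain s0 where s0: "p = s0 *s crossc l m" using common_zero[OF np(1) p(1,2)] by blast
  have "s0 \<noteq> 0" using s0 p(4) by auto
  have "dotc n (crossc l m) = 0" using p(3) s0 \<open>s0 \<noteq> 0\<close> by (simp add: dotc_linear)
  then have "det3 l m n = 0" by (simp add: vec3_simps algebra_simps)
  then obtain x y where n: "n = x *s l + y *s m" using in_span_of_det3_zero np(1) by blast
  have "x \<noteq> 0" "y \<noteq> 0" using n np(2,3) by (auto simp: crossc_linear)
  have e: "x * (a - c) * dotc l v + y * (b - c) * dotc m v = 0" for v
    using c[of v] a[of v] b[of v] by (simp add: n dotc_linear algebra_simps)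
  have "(x * (a - c)) *s l + (y * (b - c)) *s m = 0"
  proof (rule ccontr)
    assume "\<not> ?thesis"
    then show False using nonzero_dotc_ex e by (metis dotc_linear(5,7))
  qed
  then have "crossc l ((x * (a - c)) *s l + (y * (b - c)) *s m) = 0"
    "crossc m ((x * (a - c)) *s l + (y * (b - c)) *s m) = 0" by (simp_all add: crossc_linear)
  moreover have "crossc m l \<noteq> 0" using np(1) crossc_anti[of l m] by auto
  ultimately have "a = c" "b = c" using np(1) \<open>x \<noteq> 0\<close> \<open>y \<noteq> 0\<close> by (auto simp: crossc_linear)
  have "\<exists>s. D p v = c *s v + s *s p" for v
  proof -
    have "dotc l (D p v - c *s v) = 0" "dotc m (D p v - c *s v) = 0"
      using a[of v] b[of v] \<open>a = c\<close> \<open>b = c\<close> by (simp_all add: dotc_linear)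
    then obtain s where "D p v - c *s v = s *s crossc l m" using common_zero np(1) by blast
    then have "D p v = c *s v + (s / s0) *s p" using s0 \<open>s0 \<noteq> 0\<close>
      by (simp add: vector_smult_assoc algebra_simps)
    then show ?thesis by blast
  qed
  then show thesis using a \<open>a = c\<close> that by blast
qed

end

section \<open>Local behaviour at the singular points\<close>

lemma det3_dotc: "det3 u v w = dotc (crossc u v) w"
  by (simp add: vec3_simps algebra_simps)

lemma det3_zero_of_common_zero:
  assumes "l \<noteq> 0" "dotc l a = 0" "dotc l b = 0" "dotc l d = 0"
  shows "det3 a b d = 0"
proof (rule ccontr)
  assume n: "det3 a b d \<noteq> 0"
  obtain v where "dotc l v \<noteq> 0" using assms(1) nonzero_dotc_ex by blast
  moreover have "det3 a b d * dotc l v = 0"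
    using arg_cong[OF cramer[of a b d v], of "dotc l"] assms by (simp add: dotc_linear)
  ultimately show False using n by simp
qed

text \<open>The zeros of this quartic on a line are the points where \<open>e\<close>, the point and \<open>Z\<close> are dependent.  For \<open>e\<close> off an
  invariant plane and a line in that plane, these are the singular points of the foliation.\<close>
lemma (in cubic_field) quartic_on_line:
  obtains P where "degree P \<le> 4" "coeff P 0 = det3 e q (Z q)"
    "coeff P 1 = det3 e v (Z q) + det3 e q (D q v)" "coeff P 4 = det3 e v (Z v)"
    "\<And>s. poly P s = det3 e (q + s *s v) (Z (q + s *s v))"
proof
  let ?P = "[:det3 e q (Z q), det3 e v (Z q) + det3 e q (D q v), det3 e v (D q v) + det3 e q (D v q),
    det3 e v (D v q) + det3 e q (Z v), det3 e v (Z v):]"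
  show "degree ?P \<le> 4" by (simp add: degree_pCons_le)
  show "coeff ?P 0 = det3 e q (Z q)" "coeff ?P 1 = det3 e v (Z q) + det3 e q (D q v)"
     "coeff ?P 4 = det3 e v (Z v)" by (simp_all add: eval_nat_numeral)
  show "poly ?P s = det3 e (q + s *s v) (Z (q + s *s v))" for s
    by (simp add: Z_line det3_linear(5,7,9,11) algebra_simps power2_eq_square power3_eq_cube)
qed

text \<open>All that is used of a reduced convex foliation: the inflection polynomial is a product of nine pairwise
  distinct invariant lines.  The lines are given by their coefficient vectors.\<close>
locale nine_lines = cubic_field +
  fixes L :: "nat \<Rightarrow> complex ^ 3" and c :: complex
  assumes c: "c \<noteq> 0"
    and nonprop: "i < 9 \<Longrightarrow> j < 9 \<Longrightarrow> i \<noteq> j \<Longrightarrow> crossc (L i) (L j) \<noteq> 0"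
    and inv: "i < 9 \<Longrightarrow> dotc (L i) v = 0 \<Longrightarrow> dotc (L i) (Z v) = 0"
    and infl_prod: "infl v = c * (\<Prod>i<9. dotc (L i) v)"
begin

lemma L_nonzero: "i < 9 \<Longrightarrow> L i \<noteq> 0"
  using nonprop[of i 0] nonprop[of i 1] by (cases "i = 0") (auto simp: crossc_linear)

definition lines_through where "lines_through p = {i. i < 9 \<and> dotc (L i) p = 0}"

lemma finite_lines_through [simp]: "finite (lines_through p)"
  by (simp add: lines_through_def)

text \<open>A product of distinct lines vanishes at \<open>p\<close> to the order given by the number of lines through \<open>p\<close>.  This
  is how the local behaviour of the field controls the arrangement.\<close>
lemma lines_through_order:
  assumes v: "\<And>i. i < 9 \<Longrightarrow> dotc (L i) v \<noteq> 0"
    and G: "\<And>t. infl (p + t *s v) = t ^ k * G t" "(G \<longlongrightarrow> g) (at 0)"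
  shows "k \<le> card (lines_through p)" "k = card (lines_through p) \<Longrightarrow> g \<noteq> 0"
proof -
  define N where "N = card (lines_through p)"
  define H where "H t = c * (\<Prod>i\<in>lines_through p. dotc (L i) v) * (\<Prod>i\<in>{..<9} - lines_through p. dotc (L i) (p + t *s v))" for t
  have H: "infl (p + t *s v) = t ^ N * H t" for t
  proof -
    have "(\<Prod>i\<in>lines_through p. dotc (L i) (p + t *s v)) = t ^ N * (\<Prod>i\<in>lines_through p. dotc (L i) v)"
      unfolding N_def by (subst prod_constant[symmetric], subst prod.distrib[symmetric])
        (auto intro!: prod.cong simp: lines_through_def dotc_linear)
    moreover have "(\<Prod>i<9. dotc (L i) (p + t *s v)) = 
        (\<Prod>i\<in>{..<9} - lines_through p. dotc (L i) (p + t *s v)) * (\<Prod>i\<in>lines_through p. dotc (L i) (p + t *s v))"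
      by (rule prod.subset_diff) (auto simp: lines_through_def)
    ultimately show ?thesis by (simp add: infl_prod H_def)
  qed
  have "(H \<longlongrightarrow> c * (\<Prod>i\<in>lines_through p. dotc (L i) v) * (\<Prod>i\<in>{..<9} - lines_through p. dotc (L i) (p + 0 *s v))) (at 0)"
    unfolding H_def by (intro tendsto_intros)
  moreover define h where "h = c * (\<Prod>i\<in>lines_through p. dotc (L i) v) * (\<Prod>i\<in>{..<9} - lines_through p. dotc (L i) (p + 0 *s v))"
  ultimately have Hh: "(H \<longlongrightarrow> h) (at 0)" by simp
  have h0: "h \<noteq> 0"
    using c v by (auto simp: h_def lines_through_def)
  have key: "k \<le> N \<and> (k = N \<longrightarrow> g \<noteq> 0)"
  proof (rule ccontr)
    assume "\<not> ?thesis"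
    then have "N \<le> k" and *: "0 ^ (k - N) * g = 0" by auto
    have "H t = t ^ (k - N) * G t" if "t \<noteq> 0" for t
    proof -
      have "t ^ N * H t = t ^ N * (t ^ (k - N) * G t)"
        using G(1)[of t] H[of t] \<open>N \<le> k\<close> by (simp flip: mult.assoc power_add)
      then show ?thesis using that by simp
    qed
    moreover have "((\<lambda>t. t ^ (k - N) * G t) \<longlongrightarrow> 0 ^ (k - N) * g) (at 0)"
      by (intro tendsto_intros G)
    ultimately have "(H \<longlongrightarrow> 0) (at 0)"
      using * by (subst tendsto_cong[where g = "\<lambda>t. t ^ (k - N) * G t"])
        (auto simp: eventually_at_filter)
    then show False using Hh h0 tendsto_unique[OF _ Hh] by auto
  qed
  show "k \<le> card (lines_through p)" "k = card (lines_through p) \<Longrightarrow> g \<noteq> 0"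
    using key by (auto simp: N_def)
qed

lemma generic:
  assumes "finite F" "0 \<notin> F"
  obtains v where "\<And>f. f \<in> F \<Longrightarrow> dotc f v \<noteq> 0" "\<And>i. i < 9 \<Longrightarrow> dotc (L i) v \<noteq> 0"
proof -
  have "finite (F \<union> L ` {..<9})" "0 \<notin> F \<union> L ` {..<9}" using assms L_nonzero by auto
  then obtain v where "\<And>f. f \<in> F \<union> L ` {..<9} \<Longrightarrow> dotc f v \<noteq> 0" using generic_vector by blast
  then show thesis by (intro that) blast+
qed

lemma card_lines_through_ge2:
  assumes "singular p \<mu>" shows "2 \<le> card (lines_through p)"
proof -
  obtain v where v: "\<And>i. i < 9 \<Longrightarrow> dotc (L i) v \<noteq> 0" using generic[of "{}"] by auto
  obtain G where "\<And>t. infl (p + t *s v) = t ^ 2 * G t"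
    "(G \<longlongrightarrow> det3 p (linear_part p \<mu> v) (linear_part p \<mu> (linear_part p \<mu> v))) (at 0)" using infl_order2[OF assms] by blast
  then show ?thesis using lines_through_order[OF v] by blast
qed

lemma parallel_of_two:
  assumes "i \<in> lines_through p" "j \<in> lines_through p" "i \<in> lines_through q" "j \<in> lines_through q" "i \<noteq> j" "p \<noteq> 0"
  obtains s where "q = s *s p"
proof -
  have n: "crossc (L i) (L j) \<noteq> 0" using assms nonprop by (simp add: lines_through_def)
  obtain s where s: "q = s *s crossc (L i) (L j)" using common_zero[OF n] assms(3,4) by (auto simp: lines_through_def)
  obtain r where r: "p = r *s crossc (L i) (L j)" using common_zero[OF n] assms(1,2) by (auto simp: lines_through_def)
  have "r \<noteq> 0" using r assms by auto
  then have "q = (s / r) *s p" by (simp add: s r vector_smult_assoc)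
  then show thesis using that by blast
qed

lemma singular_of_two:
  assumes "i \<in> lines_through p" "j \<in> lines_through p" "i \<noteq> j" "p \<noteq> 0"
  obtains \<mu> where "singular p \<mu>"
proof -
  have "i \<in> lines_through (Z p)" "j \<in> lines_through (Z p)" using assms inv by (auto simp: lines_through_def)
  then obtain s where "Z p = s *s p" using parallel_of_two[OF assms(1,2) _ _ assms(3,4)] by blast
  then show thesis using that assms(4) by (simp add: singular_def)
qed

text \<open>The scalar is the eigenvalue transverse to any chosen one of the lines through \<open>p\<close>; the form of the
  second conclusion keeps the component along \<open>p\<close>, whose size is unknown.\<close>
lemma scalar_of_three:
  assumes "p \<noteq> 0" "3 \<le> card (lines_through p)" "i \<in> lines_through p"
  obtains \<kappa> where "\<And>v. dotc (L i) (D p v) = \<kappa> * dotc (L i) v" "\<And>v. \<exists>s. D p v = \<kappa> *s v + s *s p"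
proof -
  have "card (lines_through p - {i}) \<ge> 2" using assms by simp
  then obtain j k where jk: "j \<in> lines_through p" "k \<in> lines_through p" "j \<noteq> i" "k \<noteq> i" "j \<noteq> k"
    by (auto simp: card_le_Suc_iff numeral_2_eq_2)
  have 9: "i < 9" "j < 9" "k < 9" and p: "dotc (L i) p = 0" "dotc (L j) p = 0" "dotc (L k) p = 0"
    using assms jk by (simp_all add: lines_through_def)
  have "crossc (L i) (L j) \<noteq> 0" "crossc (L i) (L k) \<noteq> 0" "crossc (L j) (L k) \<noteq> 0"
    using nonprop 9 jk by metis+
  then show thesis
    using three_lines_scalar[OF inv[OF 9(1)] inv[OF 9(2)] inv[OF 9(3)] p assms(1)] that by blast
qed

text \<open>If five of the lines pass through \<open>p\<close>, the quartic \<open>det3 p q (Z q)\<close> has five zeros on a general line in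
  the plane, one on each of them.  Hence it vanishes identically, every line through \<open>p\<close> is invariant, and all
  points are inflection points, contradicting \<open>infl \<noteq> 0\<close>.\<close>
lemma card_lines_through_le4:
  assumes "p \<noteq> 0" shows "card (lines_through p) \<le> 4"
proof (rule ccontr)
  assume "\<not> ?thesis"
  then have five: "4 < card (lines_through p)" by simp
  obtain v where v: "\<And>i. i < 9 \<Longrightarrow> dotc (L i) v \<noteq> 0" using generic[of "{}"] by auto
  have pv: "crossc p v \<noteq> 0"
  proof
    assume "crossc p v = 0"
    then obtain s where "v = s *s p" using crossc_eq_0D assms by blast
    moreover obtain i where "i \<in> lines_through p" using five by (metis all_not_in_conv card.empty not_less_zero)
    ultimately show False using v[of i] by (auto simp: lines_through_def dotc_linear)
  qed
  have tangent: "det3 p q (Z q) = 0" if q: "det3 p q v \<noteq> 0" for q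
  proof -
    obtain P where P: "degree P \<le> 4" "coeff P 0 = det3 p q (Z q)"
      "\<And>s. poly P s = det3 p (q + s *s v) (Z (q + s *s v))"
      using quartic_on_line[of p q v] by metis
    define r where "r i = - dotc (L i) q / dotc (L i) v" for i
    have r0: "dotc (L i) (q + r i *s v) = 0" if "i < 9" for i
      using v[OF that] by (simp add: r_def dotc_linear)
    have "poly P (r i) = 0" if i: "i \<in> lines_through p" for i
    proof -
      have l: "i < 9" "dotc (L i) p = 0" using i by (auto simp: lines_through_def)
      have "dotc (L i) (Z (q + r i *s v)) = 0" using inv r0 l by blast
      then show ?thesis using det3_zero_of_common_zero[OF L_nonzero] l r0 P(3) by simp
    qed
    moreover have "inj_on r (lines_through p)"
    proof (rule inj_onI, rule ccontr)
      fix i j assume ij: "i \<in> lines_through p" "j \<in> lines_through p" "r i = r j" "i \<noteq> j"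
      then have "i \<in> lines_through (q + r i *s v)" "j \<in> lines_through (q + r i *s v)" using r0[of i] r0[of j] by (auto simp: lines_through_def)
      then obtain s where "q + r i *s v = s *s p" using parallel_of_two ij assms by metis
      then have "det3 p (q + r i *s v) v = 0" by (simp add: det3_linear)
      then show False using q by (simp add: det3_linear)
    qed
    ultimately have "card (lines_through p) \<le> card {x. poly P x = 0}" if "P \<noteq> 0"
      using poly_roots_finite[OF that] by (intro card_inj_on_le[of r]) auto
    then have "P = 0" using card_poly_roots_bound[of P] P(1) five by fastforce
    then show ?thesis using P(2) by simp
  qed
  \<comment> \<open>differentiating \<open>det3 p q (Z q) = 0\<close> in the direction \<open>Z q\<close> puts \<open>D q (Z q)\<close> into the span of \<open>p\<close> and \<open>q\<close>\<close>
  obtain q where q: "dotc (crossc p v) q \<noteq> 0" "\<And>i. i < 9 \<Longrightarrow> dotc (L i) q \<noteq> 0"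
    using generic[of "{crossc p v}"] pv by auto
  have pqv: "det3 p q v \<noteq> 0" using q(1) by (simp add: vec3_simps algebra_simps)
  obtain P where P: "coeff P 1 = det3 p (Z q) (Z q) + det3 p q (D q (Z q))"
      "\<And>s. poly P s = det3 p (q + s *s Z q) (Z (q + s *s Z q))"
    using quartic_on_line[of p q "Z q"] by metis
  have "poly P s = 0" if "poly [:det3 p q v, det3 p (Z q) v:] s \<noteq> 0" for s
    using tangent[of "q + s *s Z q"] that by (simp add: P(2) det3_linear)
  then have "poly (P * [:det3 p q v, det3 p (Z q) v:]) s = 0" for s
    by (metis mult_eq_0_iff poly_mult)
  then have "P = 0" using pqv by (metis mult_eq_0_iff pCons_eq_0_iff poly_all_0_iff_0)
  then have pD: "det3 p q (D q (Z q)) = 0" using P(1) by (simp add: det3_linear)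
  have pq: "crossc p q \<noteq> 0" using pqv by (auto simp: det3_dotc dotc_linear)
  obtain a b where ab: "Z q = a *s p + b *s q" using in_span_of_det3_zero[OF pq tangent[OF pqv]] by blast
  obtain x y where xy: "D q (Z q) = x *s p + y *s q" using in_span_of_det3_zero[OF pq pD] by blast
  have "infl q = 0" unfolding infl_def xy by (simp add: ab det3_linear)
  then show False using q c by (auto simp: infl_prod)
qed

text \<open>Every singular point is nondegenerate: otherwise the inflection polynomial vanishes at \<open>p\<close> to a higher
  order than the number of lines through \<open>p\<close>.  With at least three lines the linear part is scalar, so it is zero
  modulo \<open>p\<close> and the order is five; with two lines the leading coefficient of order two vanishes.\<close>
lemma singular_nondegenerate:
  assumes "singular p \<mu>" "crossc p v0 \<noteq> 0" shows "crossc p (linear_part p \<mu> v0) \<noteq> 0"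
proof
  assume deg: "crossc p (linear_part p \<mu> v0) = 0"
  have p0: "p \<noteq> 0" using assms(1) by (simp add: singular_def)
  then obtain s where s: "linear_part p \<mu> v0 = s *s p" using crossc_eq_0D deg by blast
  obtain v where v: "dotc (crossc p v0) v \<noteq> 0" "\<And>i. i < 9 \<Longrightarrow> dotc (L i) v \<noteq> 0"
    using generic[of "{crossc p v0}"] assms(2) by auto
  have d: "det3 p v0 v \<noteq> 0" using v(1) by (simp add: vec3_simps algebra_simps)
  show False
  proof (cases "3 \<le> card (lines_through p)")
    case True
    then obtain i where "i \<in> lines_through p" by (metis all_not_in_conv card.empty not_numeral_le_zero)
    then obtain \<kappa> where \<kappa>: "\<And>v. \<exists>s. D p v = \<kappa> *s v + s *s p" using scalar_of_three[OF p0 True] by metis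
    obtain s' where "D p v0 = \<kappa> *s v0 + s' *s p" using \<kappa> by blast
    then have "(\<kappa> - \<mu>) *s v0 = (s - s') *s p" using s by (simp add: linear_part_def vec_eq_iff algebra_simps)
    then have "(\<kappa> - \<mu>) *s crossc p v0 = 0" by (metis crossc_linear(3,9) vector_smult_rzero)
    then have "\<kappa> = \<mu>" using assms(2) by simp
    then have "\<exists>s. linear_part p \<mu> v = s *s p" for v using \<kappa>[of v] by (auto simp: linear_part_def)
    then obtain G g where "\<And>t. infl (p + t *s v) = t ^ 5 * G t" "(G \<longlongrightarrow> g) (at 0)"
      using infl_order5[OF assms(1)] by metis
    then have "5 \<le> card (lines_through p)" using lines_through_order[OF v(2)] by blast
    then show False using card_lines_through_le4[OF p0] by simp
  next
    case False
    then have 2: "2 = card (lines_through p)" using card_lines_through_ge2[OF assms(1)] by simp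
    obtain G where G: "\<And>t. infl (p + t *s v) = t ^ 2 * G t"
      "(G \<longlongrightarrow> det3 p (linear_part p \<mu> v) (linear_part p \<mu> (linear_part p \<mu> v))) (at 0)" using infl_order2[OF assms(1)] by blast
    have nz: "det3 p (linear_part p \<mu> v) (linear_part p \<mu> (linear_part p \<mu> v)) \<noteq> 0"
      using lines_through_order(2)[OF v(2) G 2] .
    define w where "w = linear_part p \<mu> v"
    have "linear_part p \<mu> (det3 p v0 v *s w) = (det3 w v0 v * (2 * \<mu>) + det3 p w v * s) *s p + det3 p v0 w *s w"
      by (subst cramer) (simp add: linear_part_linear linear_part_self[OF assms(1)] s vec_eq_iff algebra_simps flip: w_def)
    then have "det3 p w (det3 p v0 v *s linear_part p \<mu> w) = 0" 
      by (simp add: linear_part_linear det3_linear)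
    then show False using nz d by (simp add: w_def det3_linear)
  qed
qed

end

section \<open>The four singular points on an invariant line\<close>

lemma crossc_zero_in_plane:
  assumes "dotc l q = 0" "dotc l w = 0" "dotc l e \<noteq> 0" "det3 e q w = 0"
  shows "crossc q w = 0"
proof -
  have "crossc l (crossc q w) = 0" using assms(1,2) by (simp add: crossc_crossc)
  moreover have "l \<noteq> 0" using assms(3) by (auto simp: dotc_linear)
  ultimately obtain s where s: "crossc q w = s *s l" using crossc_eq_0D by blast
  then have "s * dotc l e = 0" using assms(4) by (simp add: det3_def dotc_linear dotc_commute)
  then show ?thesis using s assms(3) by simp
qed

context nine_lines begin

text \<open>A coordinate \<open>s \<mapsto> b + s a\<close> on the line \<open>L i\<close> whose point at infinity \<open>a\<close> lies on no other line.\<close>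
lemma line_coordinate:
  assumes "i < 9"
  obtains e a b where "dotc (L i) e \<noteq> 0" "dotc (L i) a = 0" "dotc (L i) b = 0"
    "det3 e a b \<noteq> 0" "lines_through a = {i}" "a \<noteq> 0" "\<And>\<mu>. \<not> singular a \<mu>" "det3 e a (Z a) \<noteq> 0"
proof -
  define F where "F = (\<lambda>j. crossc (L j) (L i)) ` ({..<9} - {i})"
  have "0 \<notin> F"
  proof
    assume "0 \<in> F"
    then obtain j where "0 = crossc (L j) (L i)" "j \<in> {..<9} - {i}" unfolding F_def by (rule imageE)
    then show False using nonprop[of j i] assms by auto
  qed
  moreover have "finite F" by (simp add: F_def)
  ultimately obtain g where "\<And>f. f \<in> F \<Longrightarrow> dotc f g \<noteq> 0" using generic_vector by blast
  then have g: "dotc (crossc (L j) (L i)) g \<noteq> 0" if "j < 9" "j \<noteq> i" for j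
    using that by (auto simp: F_def)
  define a where "a = crossc (L i) g"
  have "dotc (L j) a = dotc (crossc (L j) (L i)) g" for j
    by (simp add: a_def det3_dotc flip: det3_def)
  then have lines_through: "lines_through a = {i}" using g assms by (auto simp: lines_through_def crossc_linear dotc_linear)
  have a0: "a \<noteq> 0"
  proof
    assume "a = 0" then have "lines_through a = {..<9}" by (auto simp: lines_through_def dotc_linear)
    then show False using lines_through by (metis card_lessThan is_singletonI is_singleton_altdef numeral_eq_one_iff semiring_norm(84))
  qed
  have ns: "\<not> singular a \<mu>" for \<mu> using card_lines_through_ge2[of a \<mu>] lines_through by auto
  obtain g' where g': "dotc a g' \<noteq> 0" using nonzero_dotc_ex a0 by blast
  define b where "b = crossc (L i) g'"
  obtain e where e: "dotc (L i) e \<noteq> 0" using nonzero_dotc_ex L_nonzero assms by blast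
  have ab: "crossc a b = dotc a g' *s L i"
    by (simp add: b_def crossc_crossc a_def dotc_commute[of "crossc (L i) g"])
  have la: "dotc (L i) a = 0" by (simp add: a_def)
  have 1: "det3 e a b \<noteq> 0"
    using e g' by (simp add: det3_def ab dotc_linear dotc_commute[of e])
  have 2: "det3 e a (Z a) \<noteq> 0"
  proof
    assume "det3 e a (Z a) = 0"
    then have "crossc a (Z a) = 0" using crossc_zero_in_plane la inv[OF assms la] e by blast
    then obtain s where "Z a = s *s a" using crossc_eq_0D a0 by blast
    then show False using ns[of s] a0 by (simp add: singular_def)
  qed
  show thesis by (rule that[OF e la _ 1 lines_through a0 ns 2]) (simp add: b_def)
qed

text \<open>The singular points on an invariant line are the zeros of a binary quartic, and they are simple because
  singular points are nondegenerate.\<close>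
lemma four_points:
  assumes i: "i < 9" and e: "dotc (L i) e \<noteq> 0" "dotc (L i) a = 0" "dotc (L i) b = 0"
    "det3 e a b \<noteq> 0" "det3 e a (Z a) \<noteq> 0"
  shows "card {s. \<exists>\<mu>. singular (b + s *s a) \<mu>} = 4"
proof -
  obtain P where P: "degree P \<le> 4" "coeff P 4 = det3 e a (Z a)"
      "\<And>s. poly P s = det3 e (b + s *s a) (Z (b + s *s a))"
    using quartic_on_line[of e b a] by metis
  have deg: "degree P = 4" using P(1,2) e by (metis antisym le_degree)
  have q0: "b + s *s a \<noteq> 0" for s
  proof
    assume "b + s *s a = 0"
    then have "det3 e a (b + s *s a) = 0" by (simp add: det3_linear)
    then show False using e by (simp add: det3_linear)
  qed
  have lq: "dotc (L i) (b + s *s a) = 0" for s using e by (simp add: dotc_linear)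
  have root: "poly P s = 0 \<longleftrightarrow> (\<exists>\<mu>. singular (b + s *s a) \<mu>)" for s
  proof
    assume "poly P s = 0"
    then have "crossc (b + s *s a) (Z (b + s *s a)) = 0"
      using crossc_zero_in_plane[OF lq inv[OF i lq] e(1)] P(3) by simp
    then show "\<exists>\<mu>. singular (b + s *s a) \<mu>" using crossc_eq_0D q0 by (metis singular_def)
  next
    assume "\<exists>\<mu>. singular (b + s *s a) \<mu>"
    then obtain \<mu> where "Z (b + s *s a) = \<mu> *s (b + s *s a)" by (auto simp: singular_def)
    then show "poly P s = 0" unfolding P(3) by (simp only: det3_linear mult_zero_right)
  qed
  have "rsquarefree P" unfolding rsquarefree_roots
  proof (intro allI notI, elim conjE)
    fix s assume s: "poly P s = 0" "poly (pderiv P) s = 0"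
    define q where "q = b + s *s a"
    obtain \<mu> where \<mu>: "singular q \<mu>" using s root q_def by blast
    obtain Q where Q: "coeff Q 1 = det3 e a (Z q) + det3 e q (D q a)"
      "\<And>t. poly Q t = det3 e (q + t *s a) (Z (q + t *s a))"
      using quartic_on_line[of e q a] by metis
    have "poly Q t = poly (pcompose P [:s, 1:]) t" for t
      by (simp add: Q(2) poly_pcompose P(3) q_def vec_eq_iff algebra_simps) 
    then have "Q = pcompose P [:s, 1:]" by (simp add: poly_eq_poly_eq_iff[symmetric] fun_eq_iff)
    then have "poly (pderiv Q) 0 = 0" using s by (simp add: pderiv_pcompose poly_pcompose pderiv_pCons)
    then have "coeff Q 1 = 0" by (simp add: poly_0_coeff_0 coeff_pderiv)
    then have "det3 e a (\<mu> *s q) + det3 e q (D q a) = 0" using Q(1) \<mu> by (simp add: singular_def)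
    moreover have "det3 e a q = - det3 e q a" by (simp add: vec3_simps algebra_simps)
    ultimately have "det3 e q (linear_part q \<mu> a) = 0" by (simp add: linear_part_def det3_linear)
    moreover have "dotc (L i) (linear_part q \<mu> a) = 0"
      using invariant_linear_part[OF inv[OF i], of q a] lq[of s] e(2) by (simp add: linear_part_def dotc_linear q_def)
    ultimately have "crossc q (linear_part q \<mu> a) = 0" using crossc_zero_in_plane lq[of s] e(1) by (metis q_def)
    moreover have "crossc q a \<noteq> 0"
    proof
      assume "crossc q a = 0"
      then have "det3 e a q = 0" by (simp add: det3_def crossc_anti[of a q] dotc_linear)
      then show False using e(4) by (simp add: q_def det3_linear)
    qed
    ultimately show False using singular_nondegenerate[OF \<mu>] by blast
  qed
  then have "P = smult (lead_coeff P) (\<Prod>z|poly P z = 0. [:-z, 1:])"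
    using complex_poly_decompose_rsquarefree by metis
  then have "degree P = card {z. poly P z = 0}"
  proof -
    have "P \<noteq> 0" using deg by auto
    then have "degree (smult (lead_coeff P) (\<Prod>z|poly P z = 0. [:-z, 1:])) = card {z. poly P z = 0}"
      by (simp add: degree_prod_sum_eq)
    then show ?thesis using \<open>P = _\<close> by metis
  qed
  then show ?thesis using deg root by simp
qed


text \<open>This excludes the dual Hesse arrangement, in which all points are triple; it replaces the Camacho-Sad
  index theorem, by which four indices equal to \<open>1\<close> cannot add up to the self-intersection \<open>1\<close> of a line.
  At a point \<open>q\<close> on three lines \<open>D q\<close> is a scalar \<open>\<kappa>\<close> modulo \<open>q\<close>, which is the action of \<open>D q\<close> on the
  quotient by the plane \<open>L i\<close>, while the trace of \<open>D q\<close> on that plane is \<open>\<kappa> + 3 \<mu>\<close>.  Both are quadratic in \<open>q\<close>,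
  hence so is \<open>\<mu>\<close>.  Then \<open>Z q = \<mu> q\<close> at four points of the line yields a nonzero cubic with four zeros.\<close>
lemma double_on_line:
  assumes i: "i < 9" and e: "dotc (L i) e \<noteq> 0" "dotc (L i) a = 0" "dotc (L i) b = 0"
    "det3 e a b \<noteq> 0" "det3 e a (Z a) \<noteq> 0"
  obtains s \<mu> where "singular (b + s *s a) \<mu>" "card (lines_through (b + s *s a)) = 2"
proof (rule ccontr)
  assume no: "\<not> thesis"
  note found = that
  let ?S = "{s. \<exists>\<mu>. singular (b + s *s a) \<mu>}"
  have three: "3 \<le> card (lines_through (b + s *s a))" if "singular (b + s *s a) \<mu>" for s \<mu>
  proof -
    have "card (lines_through (b + s *s a)) \<noteq> 2" using no that found by blast
    then show ?thesis using card_lines_through_ge2[OF that] by linarith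
  qed
  \<comment> \<open>\<open>\<phi> (D q)\<close> is \<open>det3 e a b\<close> times the eigenvalue of \<open>D q\<close> transverse to \<open>L i\<close> minus its trace on \<open>L i\<close>\<close>
  define \<phi> where "\<phi> X = det3 e a b * dotc (L i) (X e) * inverse (dotc (L i) e) - det3 e (X a) b - det3 e a (X b)"
    for X :: "complex ^ 3 \<Rightarrow> complex ^ 3"
  define R where "R = [:3 * det3 e a (Z b) + \<phi> (D b), 3 * det3 e a (D b a) + \<phi> (\<lambda>w. 6 *s T b a w),
     3 * det3 e a (D a b) + \<phi> (D a), 3 * det3 e a (Z a):]"
  have R: "poly R s = 3 * det3 e a (Z (b + s *s a)) + \<phi> (D (b + s *s a))" for s
  proof -
    have "D (b + s *s a) w = D b w + s *s (6 *s T b a w) + (s * s) *s D a w" for w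
      by (simp add: D_def T_add T_scale T_commute vec_eq_iff algebra_simps)
    then have "D (b + s *s a) = (\<lambda>w. D b w + s *s (6 *s T b a w) + (s * s) *s D a w)" by blast
    moreover have "\<phi> (\<lambda>w. X w + s *s Y w + (s * s) *s W w) = \<phi> X + s * \<phi> Y + s * s * \<phi> W" for X Y W
      by (simp add: \<phi>_def det3_linear(5,7,9,11) dotc_linear(1,3) algebra_simps)
    ultimately have "\<phi> (D (b + s *s a)) = \<phi> (D b) + s * \<phi> (\<lambda>w. 6 *s T b a w) + s * s * \<phi> (D a)"
      by (simp only:)
    then show ?thesis
      by (simp add: R_def Z_line det3_linear(9,11) algebra_simps power2_eq_square power3_eq_cube)
  qed
  have "poly R s = 0" if "s \<in> ?S" for s
  proof -
    define q where "q = b + s *s a"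
    from that obtain \<mu> where \<mu>: "singular q \<mu>" unfolding q_def by blast
    have "i \<in> lines_through q" using i e by (simp add: lines_through_def q_def dotc_linear)
    moreover have q0: "q \<noteq> 0" using \<mu> by (simp add: singular_def)
    ultimately obtain \<kappa> where \<kappa>: "\<And>v. dotc (L i) (D q v) = \<kappa> * dotc (L i) v" "\<And>v. \<exists>s. D q v = \<kappa> *s v + s *s q"
      using scalar_of_three three \<mu> q_def by metis
    obtain \<alpha> \<beta> where \<alpha>: "D q a = \<kappa> *s a + \<alpha> *s q" and \<beta>: "D q b = \<kappa> *s b + \<beta> *s q" using \<kappa>(2) by metis
    have "(3 * \<mu>) *s q = D q (b + s *s a)"
      using \<mu> D_self[of q] by (simp add: singular_def vector_smult_assoc flip: q_def)
    also have "\<dots> = \<kappa> *s (b + s *s a) + (\<beta> + s * \<alpha>) *s q"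
      by (simp add: D_add D_scale \<alpha> \<beta>) (simp add: vec_eq_iff algebra_simps)
    also have "\<dots> = (\<kappa> + \<beta> + s * \<alpha>) *s q"
      by (simp add: vec_eq_iff algebra_simps flip: q_def)
    finally have 3: "3 * \<mu> = \<kappa> + \<beta> + s * \<alpha>" using q0 by (simp add: vector_mul_rcancel)
    have d: "det3 e a q = det3 e a b" "det3 e q b = s * det3 e a b" by (simp_all add: q_def det3_linear)
    have "poly R s = 3 * (\<mu> * det3 e a b) + det3 e a b * \<kappa> - (\<kappa> * det3 e a b + \<alpha> * det3 e q b) 
        - (\<kappa> * det3 e a b + \<beta> * det3 e a q)"
      using \<mu> e(1) unfolding R q_def[symmetric]
      by (simp add: \<phi>_def singular_def \<alpha> \<beta> \<kappa>(1) det3_linear d)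
    also have "\<dots> = (3 * \<mu> - (\<kappa> + \<beta> + s * \<alpha>)) * det3 e a b" by (simp add: d algebra_simps)
    finally show ?thesis using 3 by simp
  qed
  moreover have "R \<noteq> 0" using e(5) by (simp add: R_def)
  ultimately have "card ?S \<le> card {s. poly R s = 0}"
    by (intro card_mono poly_roots_finite) blast+
  also have "\<dots> \<le> degree R" using card_poly_roots_bound \<open>R \<noteq> 0\<close> by blast
  also have "\<dots> \<le> 3" by (simp add: R_def)
  finally show False using four_points[OF assms] by simp
qed

text \<open>Every block has at least two elements, and two lines meet in one point, so a block determines its singular
  point: counting blocks is counting singular points.\<close>
definition blocks where "blocks = {lines_through q | q \<mu>. singular q \<mu>}"

lemma blocks_card:
  assumes "B \<in> blocks" shows "B \<subseteq> {..<9}" "2 \<le> card B" "card B \<le> 4"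
  using assms card_lines_through_ge2 card_lines_through_le4 by (auto simp: blocks_def singular_def) (auto simp: lines_through_def)

lemma blocks_pair:
  assumes "i < 9" "j < 9" "i \<noteq> j" shows "\<exists>B\<in>blocks. i \<in> B \<and> j \<in> B"
proof -
  let ?p = "crossc (L i) (L j)"
  have "i \<in> lines_through ?p" "j \<in> lines_through ?p" using assms by (simp_all add: lines_through_def)
  moreover obtain \<mu> where "singular ?p \<mu>" using singular_of_two[OF calculation] nonprop assms by blast
  ultimately show ?thesis unfolding blocks_def by blast
qed

lemma lines_through_scale: "s \<noteq> 0 \<Longrightarrow> lines_through (s *s p) = lines_through p"
  by (simp add: lines_through_def dotc_linear)

lemma blocks_unique:
  assumes "B \<in> blocks" "B' \<in> blocks" "i \<in> B" "j \<in> B" "i \<in> B'" "j \<in> B'" "i \<noteq> j"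
  shows "B = B'"
proof -
  obtain p q where pq: "B = lines_through p" "B' = lines_through q" "p \<noteq> 0" "q \<noteq> 0"
    using assms(1,2) by (auto simp: blocks_def singular_def)
  then obtain s where "q = s *s p" using parallel_of_two assms by metis
  then show ?thesis using pq lines_through_scale[of s p] by fastforce
qed

lemma blocks_through:
  assumes "i < 9"
  shows "card {B \<in> blocks. i \<in> B} = 4" "\<exists>B\<in>blocks. i \<in> B \<and> card B = 2"
proof -
  obtain e a b where e: "dotc (L i) e \<noteq> 0" "dotc (L i) a = 0" "dotc (L i) b = 0"
    "det3 e a b \<noteq> 0" "det3 e a (Z a) \<noteq> 0" and a: "a \<noteq> 0" "\<And>\<mu>. \<not> singular a \<mu>"
    using line_coordinate[OF assms] by metis
  let ?S = "{s. \<exists>\<mu>. singular (b + s *s a) \<mu>}"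
  have l: "i \<in> lines_through (b + s *s a)" for s using assms e by (simp add: lines_through_def dotc_linear)
  have "inj_on (\<lambda>s. lines_through (b + s *s a)) ?S"
  proof (rule inj_onI)
    fix s t assume st: "s \<in> ?S" "t \<in> ?S" "lines_through (b + s *s a) = lines_through (b + t *s a)"
    then obtain \<mu> where \<mu>: "singular (b + s *s a) \<mu>" by blast
    have "lines_through (b + s *s a) \<noteq> {i}" using card_lines_through_ge2[OF \<mu>] by auto
    then obtain j where j: "j \<in> lines_through (b + s *s a)" "j \<noteq> i" using l by blast
    then obtain r where r: "b + t *s a = r *s (b + s *s a)"
      using parallel_of_two[OF l j(1) l, of t] st(3) \<mu> by (auto simp: singular_def)
    then have "det3 e a (b + t *s a) = det3 e a (r *s (b + s *s a))"
      "det3 e b (b + t *s a) = det3 e b (r *s (b + s *s a))" by simp_all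
    moreover have "det3 e b a = - det3 e a b" by (simp add: vec3_simps algebra_simps)
    ultimately show "s = t" using e(4) by (simp add: det3_linear)
  qed
  moreover have "(\<lambda>s. lines_through (b + s *s a)) ` ?S = {B \<in> blocks. i \<in> B}"
  proof (intro equalityI subsetI)
    fix B assume "B \<in> {B \<in> blocks. i \<in> B}"
    then obtain q \<mu> where q: "B = lines_through q" "singular q \<mu>" "i \<in> lines_through q" by (auto simp: blocks_def)
    have ab: "crossc a b \<noteq> 0" using e(4) by (auto simp: det3_def dotc_linear)
    have "det3 a b q = 0"
      using det3_zero_of_common_zero[OF L_nonzero[OF assms] e(2,3)] q(3) by (simp add: lines_through_def)
    then obtain x y where xy: "q = x *s a + y *s b" using in_span_of_det3_zero ab by blast
    have q0: "q \<noteq> 0" "Z q = \<mu> *s q" using q by (auto simp: singular_def)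
    have "y \<noteq> 0"
    proof
      assume "y = 0"
      then have "q = x *s a" using xy by simp
      then have "x \<noteq> 0" "x ^ 3 *s Z a = (\<mu> * x) *s a" using q0 by (auto simp: Z_scale vector_smult_assoc)
      then have "Z a = (\<mu> * x / x ^ 3) *s a"
        by (simp add: vec_eq_iff field_simps)
      then show False using a by (auto simp: singular_def)
    qed
    then have r: "b + (x / y) *s a = (1 / y) *s q" by (simp add: xy vec_eq_iff field_simps)
    have "Z ((1 / y) *s q) = (\<mu> / y\<^sup>2) *s ((1 / y) *s q)"
      by (simp add: Z_scale q0 vec_eq_iff power2_eq_square power3_eq_cube)
    then have "singular (b + (x / y) *s a) (\<mu> / y\<^sup>2)"
      using q0(1) \<open>y \<noteq> 0\<close> by (simp add: singular_def r)
    moreover have "B = lines_through (b + (x / y) *s a)" using \<open>y \<noteq> 0\<close> q(1) by (simp add: r lines_through_scale)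
    ultimately show "B \<in> (\<lambda>s. lines_through (b + s *s a)) ` ?S" by blast
  qed (use l in \<open>auto simp: blocks_def\<close>)
  ultimately show "card {B \<in> blocks. i \<in> B} = 4"
    using four_points[OF assms e] by (metis (no_types, lifting) card_image)
  show "\<exists>B\<in>blocks. i \<in> B \<and> card B = 2"
  proof -
    obtain s \<mu> where s: "singular (b + s *s a) \<mu>" "card (lines_through (b + s *s a)) = 2"
      using double_on_line[OF assms e] by blast
    have "lines_through (b + s *s a) \<in> blocks" using s(1) unfolding blocks_def by blast
    then show ?thesis using l s(2) by blast
  qed
qed

lemma concurrent:
  assumes "B \<in> blocks" "i \<in> B" "j \<in> B" "i \<noteq> j" "k < 9"
  shows "det3 (L i) (L j) (L k) = 0 \<longleftrightarrow> k \<in> B"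
proof -
  obtain q where q: "B = lines_through q" "q \<noteq> 0" using assms(1) by (auto simp: blocks_def singular_def)
  have ij: "crossc (L i) (L j) \<noteq> 0" using assms nonprop q by (simp add: lines_through_def)
  show ?thesis
  proof
    assume "det3 (L i) (L j) (L k) = 0"
    then obtain s t where "L k = s *s L i + t *s L j" using in_span_of_det3_zero ij by blast
    then show "k \<in> B" using assms q by (simp add: lines_through_def dotc_linear)
  next
    assume "k \<in> B"
    then show "det3 (L i) (L j) (L k) = 0"
      using assms q det3_zero_of_common_zero[of q] by (simp add: lines_through_def dotc_commute)
  qed
qed

end

section \<open>The incidence structure\<close>

text \<open>The incidence structure of nine lines with four intersection points on each, at least one of them
  simple, and at most four lines through a point.  The elements of \<open>V\<close> stand for the lines and the blocks for the
  intersection points.\<close>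
locale nine_point_design =
  fixes V :: "'a set" and \<B> :: "'a set set"
  assumes card_V: "card V = 9"
    and sub: "B \<in> \<B> \<Longrightarrow> B \<subseteq> V" and ge2: "B \<in> \<B> \<Longrightarrow> 2 \<le> card B" and le4: "B \<in> \<B> \<Longrightarrow> card B \<le> 4"
    and pair: "i \<in> V \<Longrightarrow> j \<in> V \<Longrightarrow> i \<noteq> j \<Longrightarrow> \<exists>B\<in>\<B>. i \<in> B \<and> j \<in> B"
    and unique: "B \<in> \<B> \<Longrightarrow> B' \<in> \<B> \<Longrightarrow> i \<in> B \<Longrightarrow> j \<in> B \<Longrightarrow> i \<in> B' \<Longrightarrow> j \<in> B' \<Longrightarrow> i \<noteq> j \<Longrightarrow> B = B'"
    and deg: "i \<in> V \<Longrightarrow> card {B \<in> \<B>. i \<in> B} = 4"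
    and double: "i \<in> V \<Longrightarrow> \<exists>B\<in>\<B>. i \<in> B \<and> card B = 2"
begin

lemma fin [simp]: "finite V" "finite \<B>"
proof -
  show V: "finite V" using card_V by (intro card_ge_0_finite) simp
  show "finite \<B>" by (rule finite_subset[of _ "Pow V"]) (use sub V in auto)
qed

lemma fin_block: "B \<in> \<B> \<Longrightarrow> finite B"
  using sub fin(1) finite_subset by blast

definition num_blocks where "num_blocks k i = card {B \<in> \<B>. i \<in> B \<and> card B = k}"

text \<open>The four blocks through \<open>i\<close> cover the eight other elements once, so their sizes minus one add up to \<open>8\<close>.\<close>
lemma local_type:
  assumes i: "i \<in> V"
  shows "num_blocks 4 i = 2 \<and> num_blocks 3 i = 0 \<and> num_blocks 2 i = 2 \<or> num_blocks 4 i = 1 \<and> num_blocks 3 i = 2 \<and> num_blocks 2 i = 1"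
proof -
  let ?S = "\<lambda>k. {B \<in> \<B>. i \<in> B \<and> card B = k}"
  have split: "{B \<in> \<B>. i \<in> B} = ?S 2 \<union> ?S 3 \<union> ?S 4"
  proof -
    have "card B = 2 \<or> card B = 3 \<or> card B = 4" if "B \<in> \<B>" for B
      using ge2[OF that] le4[OF that] by linarith
    then show ?thesis by blast
  qed
  have 4: "num_blocks 2 i + num_blocks 3 i + num_blocks 4 i = 4"
  proof -
    have "card (?S 2 \<union> ?S 3 \<union> ?S 4) = card (?S 2 \<union> ?S 3) + card (?S 4)" by (rule card_Un_disjoint) auto
    moreover have "card (?S 2 \<union> ?S 3) = card (?S 2) + card (?S 3)" by (rule card_Un_disjoint) auto
    ultimately show ?thesis using deg[OF i] unfolding split num_blocks_def by linarith
  qed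
  have "V - {i} = (\<Union>B\<in>{B \<in> \<B>. i \<in> B}. B - {i})"
  proof (intro equalityI subsetI)
    fix j assume "j \<in> V - {i}"
    then show "j \<in> (\<Union>B\<in>{B \<in> \<B>. i \<in> B}. B - {i})" using pair[OF i, of j] by auto
  qed (use sub in auto)
  then have "card (V - {i}) = card (\<Union>B\<in>{B \<in> \<B>. i \<in> B}. B - {i})" by (rule arg_cong)
  also have "\<dots> = (\<Sum>B\<in>{B \<in> \<B>. i \<in> B}. card (B - {i}))"
    using fin_block unique by (intro card_UN_disjoint) (simp, simp, blast)
  also have "\<dots> = (\<Sum>B\<in>{B \<in> \<B>. i \<in> B}. card B - 1)"
    by (intro sum.cong) auto
  also have "\<dots> = (\<Sum>B\<in>?S 2. card B - 1) + (\<Sum>B\<in>?S 3. card B - 1) + (\<Sum>B\<in>?S 4. card B - 1)"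
  proof -
    have "sum g (?S 2 \<union> ?S 3 \<union> ?S 4) = sum g (?S 2 \<union> ?S 3) + sum g (?S 4)" for g :: "'a set \<Rightarrow> nat"
      by (rule sum.union_disjoint) auto
    moreover have "sum g (?S 2 \<union> ?S 3) = sum g (?S 2) + sum g (?S 3)" for g :: "'a set \<Rightarrow> nat"
      by (rule sum.union_disjoint) auto
    ultimately show ?thesis unfolding split by simp
  qed
  also have "\<dots> = num_blocks 2 i + 2 * num_blocks 3 i + 3 * num_blocks 4 i"
    by (simp add: num_blocks_def)
  finally have 8: "num_blocks 2 i + 2 * num_blocks 3 i + 3 * num_blocks 4 i = 8"
    using card_V i by simp
  have "?S 2 \<noteq> {}" using double[OF i] by auto
  then have "num_blocks 2 i \<noteq> 0" unfolding num_blocks_def by simp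
  then have "num_blocks 4 i = 1 \<or> num_blocks 4 i = 2" using 4 8 by linarith
  then show ?thesis using 4 8 by (elim disjE) auto
qed

definition triangle where "triangle = {i \<in> V. num_blocks 4 i = 2}"

lemma double_count: "(\<Sum>i\<in>V. num_blocks k i) = k * card {B \<in> \<B>. card B = k}"
proof -
  have "(\<Sum>i\<in>V. num_blocks k i) = (\<Sum>i\<in>V. card {B \<in> {B \<in> \<B>. card B = k}. i \<in> B})"
    unfolding num_blocks_def by (intro sum.cong arg_cong[where f = card]) auto
  also have "\<dots> = k * card {B \<in> \<B>. card B = k}"
  proof (rule sum_multicount)
    show "\<forall>B\<in>{B \<in> \<B>. card B = k}. card {i \<in> V. i \<in> B} = k"
    proof
      fix B assume B: "B \<in> {B \<in> \<B>. card B = k}"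
      then have "{i \<in> V. i \<in> B} = B" using sub by auto
      then show "card {i \<in> V. i \<in> B} = k" using B by simp
    qed
  qed auto
  finally show ?thesis .
qed

text \<open>Counting incidences with blocks of size four and three gives \<open>9 + a = 4 p\<close> and \<open>2 (9 - a) = 3 q\<close> for the number
  \<open>a\<close> of elements on two large blocks; the only solution with \<open>a \<le> 9\<close> is \<open>a = 3\<close>.\<close>
lemma global_type: "card triangle = 3" "card {B \<in> \<B>. card B = 4} = 3"
proof -
  have triangle: "triangle \<subseteq> V" "finite triangle" by (auto simp: triangle_def)
  have b: "card (V - triangle) = 9 - card triangle" using triangle card_V by (simp add: card_Diff_subset)
  have le: "card triangle \<le> 9" using triangle card_V card_mono fin(1) by metis
  have in_A: "num_blocks 4 i = 2" "num_blocks 3 i = 0" if "i \<in> triangle" for i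
    using local_type[of i] that by (auto simp: triangle_def)
  have off_A: "num_blocks 4 i = 1" "num_blocks 3 i = 2" if "i \<in> V - triangle" for i
    using local_type[of i] that by (auto simp: triangle_def)
  have split: "(\<Sum>i\<in>V. num_blocks k i) = (\<Sum>i\<in>V - triangle. num_blocks k i) + (\<Sum>i\<in>triangle. num_blocks k i)" for k
    by (rule sum.subset_diff[OF triangle(1) fin(1)])
  have "9 - card triangle + 2 * card triangle = 4 * card {B \<in> \<B>. card B = 4}"
    using split[of 4] by (simp add: in_A off_A b double_count)
  then have 1: "9 + card triangle = 4 * card {B \<in> \<B>. card B = 4}" using le by linarith
  have 2: "2 * (9 - card triangle) = 3 * card {B \<in> \<B>. card B = 3}"
    using split[of 3] by (simp add: in_A off_A b double_count)
  have "a = 3" if "9 + a = 4 * p" "2 * (9 - a) = 3 * q" "a \<le> 9" for a p q :: nat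
    using that by presburger
  from this[OF 1 2 le] show "card triangle = 3" .
  then show "card {B \<in> \<B>. card B = 4} = 3" using 1 by simp
qed

text \<open>There are three large blocks, and each element of \<open>triangle\<close> misses exactly one of them.  Different elements miss
  different blocks, as two blocks share at most one element.\<close>
lemma triangle_incidences:
  obtains x y w Q1 Q2 Q3 where "distinct [x, y, w]" "triangle = {x, y, w}"
    "{B \<in> \<B>. card B = 4} = {Q1, Q2, Q3}" "distinct [Q1, Q2, Q3]"
    "x \<in> Q2" "x \<in> Q3" "x \<notin> Q1" "y \<in> Q1" "y \<in> Q3" "y \<notin> Q2" "w \<in> Q1" "w \<in> Q2" "w \<notin> Q3"
proof -
  let ?Q = "{B \<in> \<B>. card B = 4}"
  obtain x y w where xyw: "triangle = {x, y, w}" "x \<noteq> y" "y \<noteq> w" "x \<noteq> w"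
    using global_type(1) by (auto simp: card_3_iff)
  have miss: "\<exists>Q. {B \<in> ?Q. i \<notin> B} = {Q}" if "i \<in> triangle" for i
  proof -
    have "card {B \<in> ?Q. i \<in> B} = 2" using that by (simp add: triangle_def num_blocks_def conj_ac)
    moreover have "{B \<in> ?Q. i \<notin> B} = ?Q - {B \<in> ?Q. i \<in> B}" by auto
    ultimately have "card {B \<in> ?Q. i \<notin> B} = 1" 
      using global_type(2) by (subst \<open>{B \<in> ?Q. i \<notin> B} = _\<close>, subst card_Diff_subset) auto
    then show ?thesis by (rule card_1_singletonE) blast
  qed
  obtain Q1 where Q1: "{B \<in> ?Q. x \<notin> B} = {Q1}" using miss xyw by blast
  obtain Q2 where Q2: "{B \<in> ?Q. y \<notin> B} = {Q2}" using miss xyw by blast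
  obtain Q3 where Q3: "{B \<in> ?Q. w \<notin> B} = {Q3}" using miss xyw by blast
  have inj: "Q \<noteq> Q'" if "{B \<in> ?Q. i \<notin> B} = {Q}" "{B \<in> ?Q. j \<notin> B} = {Q'}" "i \<noteq> j" for i j Q Q'
  proof
    assume "Q = Q'"
    have "card (?Q - {Q}) = 2" 
    proof -
      have "Q \<in> ?Q" using equalityD2[OF that(1)] by simp
      then show ?thesis using global_type(2) by (simp add: card_Diff_singleton)
    qed
    then obtain R S where RS: "?Q - {Q} = {R, S}" "R \<noteq> S" by (auto simp: card_2_iff)
    then have "R \<in> ?Q - {Q}" "S \<in> ?Q - {Q}" by (metis insertI1, metis insertCI)
    moreover have "k \<in> B" if "B \<in> ?Q - {Q}" "{B \<in> ?Q. k \<notin> B} \<subseteq> {Q}" for k B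
      using that by blast
    ultimately have "i \<in> R" "i \<in> S" "j \<in> R" "j \<in> S" "R \<in> \<B>" "S \<in> \<B>"
      using equalityD1[OF that(1)] equalityD1[OF that(2)] \<open>Q = Q'\<close> by (meson, simp_all)
    then show False using unique RS(2) that(3) by metis
  qed
  have d: "Q1 \<noteq> Q2" "Q1 \<noteq> Q3" "Q2 \<noteq> Q3" using inj Q1 Q2 Q3 xyw by blast+
  have "{Q1, Q2, Q3} \<subseteq> ?Q" using Q1 Q2 Q3 by blast
  moreover have "card {Q1, Q2, Q3} = card ?Q" using d global_type(2) by simp
  ultimately have Q: "?Q = {Q1, Q2, Q3}" by (intro card_subset_eq[symmetric]) auto
  have mem: "k \<in> B \<longleftrightarrow> B \<noteq> R" if "{B \<in> ?Q. k \<notin> B} = {R}" "B \<in> ?Q" for k B R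
    using equalityD1[OF that(1)] equalityD2[OF that(1)] that(2) by blast
  have inQ: "Q1 \<in> ?Q" "Q2 \<in> ?Q" "Q3 \<in> ?Q" unfolding Q by simp_all
  have "distinct [x, y, w]" "distinct [Q1, Q2, Q3]" using xyw d by simp_all
  moreover have "x \<in> Q2" "x \<in> Q3" "x \<notin> Q1" using mem[OF Q1 inQ(1)] mem[OF Q1 inQ(2)] mem[OF Q1 inQ(3)] d by simp_all
  moreover have "y \<in> Q1" "y \<in> Q3" "y \<notin> Q2" using mem[OF Q2 inQ(1)] mem[OF Q2 inQ(2)] mem[OF Q2 inQ(3)] d by simp_all
  moreover have "w \<in> Q1" "w \<in> Q2" "w \<notin> Q3" using mem[OF Q3 inQ(1)] mem[OF Q3 inQ(2)] mem[OF Q3 inQ(3)] d by simp_all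
  ultimately show thesis using that[OF _ xyw(1) Q] by blast
qed

lemma third_point:
  assumes "B \<in> \<B>" "card B = 3" "p \<in> B" "q \<in> B" "p \<noteq> q"
  obtains r where "B = {p, q, r}" "r \<noteq> p" "r \<noteq> q"
proof -
  have "card (B - {p, q}) = 1" using card_Diff_subset[of "{p, q}" B] assms(2-5) by simp
  then obtain r where "B - {p, q} = {r}" by (rule card_1_singletonE)
  then have "B = {p, q, r}" "r \<noteq> p" "r \<noteq> q" using assms by auto
  then show thesis using that by blast
qed

lemma remaining_two:
  assumes "card Q = 4" "y \<in> Q" "w \<in> Q" "y \<noteq> w"
  obtains b b' where "Q = {y, w, b, b'}" "distinct [y, w, b, b']"
proof -
  have "card (Q - {y, w}) = 2" using card_Diff_subset[of "{y, w}" Q] assms by simp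
  then obtain b b' where b: "Q - {y, w} = {b, b'}" "b \<noteq> b'" by (auto simp: card_2_iff)
  then have "Q = {y, w, b, b'}" using assms by auto
  moreover have "distinct [y, w, b, b']" using b assms by auto
  ultimately show thesis using that by blast
qed

text \<open>Up to labelling the structure is the reflection arrangement \<open>B\<^sub>3\<close>: \<open>x\<close>, \<open>y\<close>, \<open>w\<close> are the coordinate lines and the
  pairs \<open>a, a'\<close>, \<open>b, b'\<close>, \<open>c, c'\<close> the lines \<open>y = \<plusminus>w\<close>, \<open>w = \<plusminus>x\<close>, \<open>x = \<plusminus>y\<close>.\<close>
lemma B3_configuration:
  obtains x y w a a' b b' c c' where
    "distinct [x, y, w, a, a', b, b', c, c']" "V = {x, y, w, a, a', b, b', c, c'}"
    "{y, w, a, a'} \<in> \<B>" "{w, x, b, b'} \<in> \<B>" "{x, y, c, c'} \<in> \<B>"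
    "{a, b, c} \<in> \<B>" "{a, b', c'} \<in> \<B>" "{a', b, c'} \<in> \<B>" "{a', b', c} \<in> \<B>"
proof -
  obtain x y w Q1 Q2 Q3 where xyw: "distinct [x, y, w]" "triangle = {x, y, w}"
    and Q: "{B \<in> \<B>. card B = 4} = {Q1, Q2, Q3}" "distinct [Q1, Q2, Q3]"
    and inc: "x \<in> Q2" "x \<in> Q3" "x \<notin> Q1" "y \<in> Q1" "y \<in> Q3" "y \<notin> Q2" "w \<in> Q1" "w \<in> Q2" "w \<notin> Q3"
    by (rule triangle_incidences)
  have QB: "Q1 \<in> \<B>" "Q2 \<in> \<B>" "Q3 \<in> \<B>" "card Q1 = 4" "card Q2 = 4" "card Q3 = 4" using Q(1) by blast+
  have ne: "y \<noteq> w" "w \<noteq> x" "x \<noteq> y" and neQ: "Q1 \<noteq> Q2" "Q1 \<noteq> Q3" "Q2 \<noteq> Q3"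
    using xyw(1) Q(2) by auto
  obtain a a' where a: "Q1 = {y, w, a, a'}" "distinct [y, w, a, a']"
    by (rule remaining_two[OF QB(4) inc(4,7) ne(1)])
  obtain b b' where b: "Q2 = {w, x, b, b'}" "distinct [w, x, b, b']"
    by (rule remaining_two[OF QB(5) inc(8,1) ne(2)])
  obtain c0 c0' where c0: "Q3 = {x, y, c0, c0'}" "distinct [x, y, c0, c0']"
    by (rule remaining_two[OF QB(6) inc(2,5) ne(3)])
  have meet: "i = w" if "i \<in> Q1" "i \<in> Q2" for i using unique[OF QB(1,2) that(1) inc(7) that(2) inc(8)] neQ by blast
  have meet': "i = y" if "i \<in> Q1" "i \<in> Q3" for i using unique[OF QB(1,3) that(1) inc(4) that(2) inc(5)] neQ by blast
  have meet'': "i = x" if "i \<in> Q2" "i \<in> Q3" for i using unique[OF QB(2,3) that(1) inc(1) that(2) inc(2)] neQ by blast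
  have aQ: "a \<in> Q1" "a' \<in> Q1" unfolding a(1) by simp_all
  have bQ: "b \<in> Q2" "b' \<in> Q2" unfolding b(1) by simp_all
  have cQ: "c0 \<in> Q3" "c0' \<in> Q3" unfolding c0(1) by simp_all
  have na: "i \<notin> Q2" "i \<notin> Q3" "i \<in> Q1" "i \<noteq> y" "i \<noteq> w" if "i \<in> {a, a'}" for i
    using meet[of i] meet'[of i] a(2) aQ that by auto
  have nb: "i \<notin> Q1" "i \<notin> Q3" "i \<in> Q2" "i \<noteq> w" "i \<noteq> x" if "i \<in> {b, b'}" for i
    using meet[of i] meet''[of i] b(2) bQ that by auto
  have abQ: "a \<notin> Q2" "a' \<notin> Q2" "a \<notin> Q3" "a' \<notin> Q3" "b \<notin> Q3" "b' \<notin> Q3"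
    using na(1,2)[of a] na(1,2)[of a'] nb(2)[of b] nb(2)[of b'] by simp_all
  have apart: "x \<noteq> a" "x \<noteq> a'" "y \<noteq> b" "y \<noteq> b'" "w \<noteq> c0" "w \<noteq> c0'" "a \<noteq> b" "a \<noteq> b'" "a' \<noteq> b" "a' \<noteq> b'"
     "a \<noteq> c0" "a \<noteq> c0'" "a' \<noteq> c0" "a' \<noteq> c0'" "b \<noteq> c0" "b \<noteq> c0'" "b' \<noteq> c0" "b' \<noteq> c0'"
    using aQ bQ cQ inc(3,6,9) abQ by blast+
  have dist: "distinct [x, y, w, a, a', b, b', c0, c0']"
    using a(2) b(2) c0(2) ne apart by simp
  have V: "V = {x, y, w, a, a', b, b', c0, c0'}"
  proof (rule card_subset_eq[symmetric])
    have "Q1 \<union> Q2 \<union> Q3 \<subseteq> V" using sub QB by blast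
    then show "{x, y, w, a, a', b, b', c0, c0'} \<subseteq> V" using inc aQ bQ cQ by blast
    show "card {x, y, w, a, a', b, b', c0, c0'} = card V"
      using distinct_card[OF dist] card_V by simp
  qed simp
  \<comment> \<open>an element outside \<open>triangle\<close> is joined by a block of size two to the one element of \<open>triangle\<close> that is not on its
    large block; this is its only such block, so it is joined to the other elements off its large block by triples\<close>
  have triple: "\<exists>r. {i, j, r} \<in> \<B> \<and> r \<in> {c0, c0'}" if ij: "i \<in> {a, a'}" "j \<in> {b, b'}" for i j
  proof -
    note ni = na[OF ij(1)] and nj = nb[OF ij(2)]
    have "i \<noteq> x" using ni(3) inc(3) by blast
    then have iA: "i \<notin> triangle" using ni xyw(2) by blast
    have inV: "i \<in> V" "j \<in> V" "x \<in> V" using sub QB ni nj inc by blast+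
    have "i \<noteq> j" using ni nj by blast
    have n2: "num_blocks 2 i = 1" using local_type[OF inV(1)] iA inV(1) by (auto simp: triangle_def)
    have no3: "card B \<noteq> 3" if "B \<in> \<B>" "k \<in> B" "k \<in> triangle" for B k
    proof
      assume "card B = 3"
      then have "B \<in> {B \<in> \<B>. k \<in> B \<and> card B = 3}" using that by simp
      moreover have "num_blocks 3 k = 0" using local_type[of k] that(3) by (auto simp: triangle_def)
      ultimately show False by (auto simp: num_blocks_def)
    qed
    have size: "card B = 2 \<or> card B = 3" if "B \<in> \<B>" "B \<noteq> Q1" "B \<noteq> Q2" "B \<noteq> Q3" for B
    proof -
      have "card B \<noteq> 4" using that Q(1) by blast
      then show ?thesis using ge2[OF that(1)] le4[OF that(1)] by linarith
    qed
    obtain X where X: "X \<in> \<B>" "i \<in> X" "x \<in> X" using pair[OF inV(1,3) \<open>i \<noteq> x\<close>] by blast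
    have "X \<noteq> Q1" "X \<noteq> Q2" "X \<noteq> Q3" using X inc ni by blast+
    moreover have "card X \<noteq> 3" using no3[OF X(1,3)] xyw(2) by simp
    ultimately have X2: "card X = 2" using size[OF X(1)] by blast
    obtain B where B: "B \<in> \<B>" "i \<in> B" "j \<in> B" using pair[OF inV(1,2) \<open>i \<noteq> j\<close>] by blast
    have BQ: "B \<noteq> Q1" "B \<noteq> Q2" "B \<noteq> Q3" using B ni nj by blast+
    have "X \<noteq> B"
    proof
      assume "X = B"
      then have "{i, j, x} \<subseteq> X" using B X by blast
      then have "card {i, j, x} \<le> card X" using fin_block[OF X(1)] by (intro card_mono)
      then show False using X2 \<open>i \<noteq> j\<close> \<open>i \<noteq> x\<close> nj(5) by simp
    qed
    have "card B \<noteq> 2"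
    proof
      assume "card B = 2"
      then have "{X, B} \<subseteq> {B \<in> \<B>. i \<in> B \<and> card B = 2}" using X X2 B by blast
      then have "card {X, B} \<le> num_blocks 2 i" unfolding num_blocks_def by (intro card_mono) simp_all
      then show False using n2 \<open>X \<noteq> B\<close> by simp
    qed
    then have B3: "card B = 3" using size[OF B(1) BQ] by blast
    obtain r where r: "B = {i, j, r}" "r \<noteq> i" "r \<noteq> j" by (rule third_point[OF B(1) B3 B(2,3) \<open>i \<noteq> j\<close>])
    have rB: "r \<in> B" unfolding r(1) by simp
    have "r \<notin> {x, y, w}" using no3[OF B(1) rB] B3 xyw(2) by blast
    moreover have "r \<notin> Q1" using unique[OF B(1) QB(1) B(2) rB ni(3)] r(2) BQ(1) by blast
    moreover have "r \<notin> Q2" using unique[OF B(1) QB(2) B(3) rB nj(3)] r(3) BQ(2) by blast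
    moreover have "r \<in> {x, y, w, a, a', b, b', c0, c0'}" using sub[OF B(1)] rB V by blast
    ultimately have "r \<in> {c0, c0'}" using aQ bQ by blast
    then show ?thesis using B(1) r(1) by blast
  qed
  obtain c where c: "{a, b, c} \<in> \<B>" "c \<in> {c0, c0'}" using triple[of a b] by auto
  define c' where "c' = (if c = c0 then c0' else c0)"
  have swap: "c = c0 \<and> c' = c0' \<or> c = c0' \<and> c' = c0" using c(2) c0(2) by (auto simp: c'_def)
  have "{c0, c0'} = {c, c'}" using swap by blast
  moreover have "c \<noteq> c'" using swap c0(2) by auto
  ultimately have cc: "{c0, c0'} = {c, c'}" "c \<noteq> c'" by blast+
  have dist': "distinct [x, y, w, a, a', b, b', c, c']"
    using swap
  proof (elim disjE conjE)
    assume "c = c0" "c' = c0'" then show ?thesis using dist by simp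
  next
    assume "c = c0'" "c' = c0" then show ?thesis using dist cc(2) by simp
  qed
  have ne': "a \<noteq> c" "b \<noteq> c" "b' \<noteq> b" "a' \<noteq> a" "a' \<noteq> c'" "b' \<noteq> c" "a' \<noteq> b" "a' \<noteq> c" "b' \<noteq> c'" "b' \<noteq> a" "b' \<noteq> a'"
    using dist' by auto
  have V': "V = {x, y, w, a, a', b, b', c, c'}" using V cc(1) by blast
  have Q3: "{x, y, c, c'} \<in> \<B>" using QB(3) c0(1) cc(1) by simp
  have 2: "{a, b', c'} \<in> \<B>"
  proof -
    obtain r where r: "{a, b', r} \<in> \<B>" "r \<in> {c, c'}" using triple[of a b'] unfolding cc(1) by blast
    have "r \<noteq> c"
    proof
      assume "r = c"
      then have "{a, b', r} = {a, b, c}" using unique[OF r(1) c(1), of a c] ne' by simp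
      then have "b' \<in> {a, b, c}" by blast
      then show False using ne' by simp
    qed
    then show ?thesis using r by auto
  qed
  have 3: "{a', b, c'} \<in> \<B>"
  proof -
    obtain r where r: "{a', b, r} \<in> \<B>" "r \<in> {c, c'}" using triple[of a' b] unfolding cc(1) by blast
    have "r \<noteq> c"
    proof
      assume "r = c"
      then have "{a', b, r} = {a, b, c}" using unique[OF r(1) c(1), of b c] ne' by simp
      then have "a' \<in> {a, b, c}" by blast
      then show False using ne' by simp
    qed
    then show ?thesis using r by auto
  qed
  have 4: "{a', b', c} \<in> \<B>"
  proof -
    obtain r where r: "{a', b', r} \<in> \<B>" "r \<in> {c, c'}" using triple[of a' b'] unfolding cc(1) by blast
    have "r \<noteq> c'"
    proof
      assume "r = c'"
      then have "{a', b', r} = {a', b, c'}" using unique[OF r(1) 3, of a' c'] ne' by simp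
      then have "b' \<in> {a', b, c'}" by blast
      then show False using ne' by simp
    qed
    then show ?thesis using r by auto
  qed
  show thesis using that[OF dist' V'] QB(1,2) a(1) b(1) Q3 c(1) 2 3 4 by simp
qed

end

section \<open>Coordinates for the arrangement\<close>

definition proportional :: "complex ^ 3 \<Rightarrow> complex ^ 3 \<Rightarrow> bool" where
  "proportional u v \<longleftrightarrow> (\<exists>s. s \<noteq> 0 \<and> u = s *s v)"

lemma coeffs_in_pencil:
  assumes "crossc U V \<noteq> 0" "det3 U V A = 0" "crossc U A \<noteq> 0" "crossc V A \<noteq> 0"
  obtains p q where "A = p *s U + q *s V" "p \<noteq> 0" "q \<noteq> 0"
proof -
  obtain p q where A: "A = p *s U + q *s V" using in_span_of_det3_zero assms(1,2) by blast
  have "p \<noteq> 0" "q \<noteq> 0" using assms(3,4) by (auto simp: A crossc_linear)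
  then show thesis using that A by blast
qed

text \<open>Scaling makes the first line in each of the three pencils a difference of coordinates.  The four
  triple points then say that the slopes of the other three are pairwise inverse, hence all \<open>-1\<close>.\<close>
lemma B3_normal_form:
  assumes d: "det3 X Y W \<noteq> 0"
    and A: "det3 Y W A = 0" "crossc Y A \<noteq> 0" "crossc W A \<noteq> 0"
    and A': "det3 Y W A' = 0" "crossc Y A' \<noteq> 0" "crossc W A' \<noteq> 0"
    and B: "det3 W X B = 0" "crossc W B \<noteq> 0" "crossc X B \<noteq> 0"
    and B': "det3 W X B' = 0" "crossc W B' \<noteq> 0" "crossc X B' \<noteq> 0"
    and C: "det3 X Y C = 0" "crossc X C \<noteq> 0" "crossc Y C \<noteq> 0"
    and C': "det3 X Y C' = 0" "crossc X C' \<noteq> 0" "crossc Y C' \<noteq> 0" "crossc C C' \<noteq> 0"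
    and triple: "det3 A B C = 0" "det3 A B' C' = 0" "det3 A' B C' = 0" "det3 A' B' C = 0"
  obtains x y w where "det3 x y w \<noteq> 0" "proportional X x" "proportional Y y" "proportional W w"
    "proportional A (y - w)" "proportional A' (y + w)" "proportional B (w - x)" "proportional B' (w + x)"
    "proportional C (x - y)" "proportional C' (x + y)"
proof -
  have YW: "crossc Y W \<noteq> 0" and WX: "crossc W X \<noteq> 0" and XY: "crossc X Y \<noteq> 0"
    using d det3_rotate[of X Y W] det3_rotate[of Y W X] by (auto simp: det3_def dotc_linear)
  obtain p q where C2: "C = p *s X + q *s Y" "p \<noteq> 0" "q \<noteq> 0" using coeffs_in_pencil[OF XY C] by blast
  obtain r s where A2: "A = r *s Y + s *s W" "r \<noteq> 0" "s \<noteq> 0" using coeffs_in_pencil[OF YW A] by blast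
  define x where "x = p *s X"
  define y where "y = (- q) *s Y"
  define w where "w = (q * s / r) *s W"
  have XYW: "X = (1 / p) *s x" "Y = (- 1 / q) *s y" "W = (r / (q * s)) *s w"
    using C2 A2 by (simp_all add: x_def y_def w_def vec_eq_iff)
  have d': "det3 x y w \<noteq> 0"
    using d C2 A2 by (simp only: x_def y_def w_def det3_linear) simp
  have C3: "C = x - y" by (simp add: C2 x_def y_def)
  have "A = (- r / q) *s (y - w)" using A2 C2 by (simp add: XYW vec_eq_iff field_simps)
  then obtain m where A3: "A = m *s (y - w)" "m \<noteq> 0" using A2(2) C2(3) by (metis divide_eq_0_iff neg_equal_0_iff_equal)
  obtain t' u' where B2: "B = t' *s W + u' *s X" "t' \<noteq> 0" "u' \<noteq> 0" using coeffs_in_pencil[OF WX B] by blast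
  define t where "t = t' * (r / (q * s))"
  define u where "u = u' * (1 / p)"
  have B3: "B = t *s w + u *s x" "t \<noteq> 0" "u \<noteq> 0"
    using B2 C2 A2 by (simp_all only: t_def u_def XYW vector_smult_assoc) simp_all
  have "det3 (y - w) B C = (t + u) * det3 x y w"
    by (simp add: B3 C3) (simp add: vec3_simps algebra_simps)
  then have "t + u = 0" using triple(1) A3(2) d' unfolding A3(1) det3_linear(3) by simp
  then have u: "u = - t" by (simp add: eq_neg_iff_add_eq_0 add.commute)
  have B4: "B = t *s (w - x)" by (simp add: B3 u vec_eq_iff algebra_simps)
  have slope: "\<exists>a b k. Q = a *s (U - k *s V) \<and> a \<noteq> 0 \<and> k \<noteq> 0"
    if "crossc U' V' \<noteq> 0" "det3 U' V' Q = 0" "crossc U' Q \<noteq> 0" "crossc V' Q \<noteq> 0" "U' = m *s U" "V' = l *s V" "m \<noteq> 0" "l \<noteq> 0"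
    for U V U' V' Q m l
  proof -
    from coeffs_in_pencil[OF that(1-4)]
    obtain f g where "Q = f *s U' + g *s V'" "f \<noteq> 0" "g \<noteq> 0" by blast
    then have "Q = (f * m) *s (U - (- (g * l) / (f * m)) *s V)" "f * m \<noteq> 0" "- (g * l) / (f * m) \<noteq> 0"
      using that(7,8) by (simp_all add: that(5,6) vec_eq_iff field_simps)
    then show ?thesis by blast
  qed
  obtain f \<kappa> where C4: "C' = f *s (x - \<kappa> *s y)" "f \<noteq> 0" "\<kappa> \<noteq> 0"
    using slope[OF XY C'(1-3) XYW(1,2)] C2 by auto
  obtain g \<nu> where A4: "A' = g *s (y - \<nu> *s w)" "g \<noteq> 0" "\<nu> \<noteq> 0"
    using slope[OF YW A' XYW(2,3)] C2 A2 by auto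
  obtain h \<rho> where B5: "B' = h *s (w - \<rho> *s x)" "h \<noteq> 0" "\<rho> \<noteq> 0"
    using slope[OF WX B' XYW(3,1)] C2 A2 by auto
  have "det3 (y - w) (w - \<rho> *s x) (x - \<kappa> *s y) = (1 - \<rho> * \<kappa>) * det3 x y w"
    "det3 (y - \<nu> *s w) (w - x) (x - \<kappa> *s y) = (1 - \<nu> * \<kappa>) * det3 x y w"
    "det3 (y - \<nu> *s w) (w - \<rho> *s x) (x - y) = (1 - \<nu> * \<rho>) * det3 x y w"
    by (simp_all add: vec3_simps algebra_simps)
  then have inv: "\<rho> * \<kappa> = 1" "\<nu> * \<kappa> = 1" "\<nu> * \<rho> = 1"
    using triple(2-4) A3(2) B3(2) C4(2) A4(2) B5(2) d'
    unfolding A3(1) B4 C3 C4(1) A4(1) B5(1) det3_linear(3,7,11) by auto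
  have "\<rho> = \<nu>" using inv(1,2) C4(3) by (metis mult_right_cancel)
  moreover have "\<kappa> = \<nu>" using inv(1,3) B5(3) by (metis mult.commute mult_right_cancel)
  ultimately have "\<kappa>\<^sup>2 = 1" using inv by (simp add: power2_eq_square)
  moreover have "\<kappa> \<noteq> 1" using C'(4) C4(1) by (auto simp: C3 crossc_linear(3,9))
  ultimately have k: "\<kappa> = -1" by (simp add: power2_eq_1_iff)
  then have "\<nu> = -1" "\<rho> = -1" using \<open>\<kappa> = \<nu>\<close> \<open>\<rho> = \<nu>\<close> by simp_all
  then have "C' = f *s (x + y)" "A' = g *s (y + w)" "B' = h *s (w + x)"
    using C4 A4 B5 k by (simp_all add: vec_eq_iff)
  moreover have "1 / p \<noteq> 0" "- 1 / q \<noteq> 0" "r / (q * s) \<noteq> 0" using C2 A2 by simp_all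
  moreover have "C = 1 *s (x - y)" by (simp add: C3)
  ultimately show thesis
    using d' XYW A3 B4 B3(2) C4(2) A4(2) B5(2) that[of x y w] unfolding proportional_def
    by (metis one_neq_zero)
qed

section \<open>Cubic fields leaving the arrangement invariant\<close>

lemma (in nine_lines) B3_arrangement:
  obtains x y w where "det3 x y w \<noteq> 0"
    "\<And>f v. f \<in> {x, y, w, y - w, y + w, w - x, w + x, x - y, x + y} \<Longrightarrow> dotc f v = 0 \<Longrightarrow> dotc f (Z v) = 0"
proof -
  interpret design: nine_point_design "{..<9}" blocks
  proof
    fix i assume "i \<in> {..<9::nat}"
    then show "card {B \<in> blocks. i \<in> B} = 4" "\<exists>B\<in>blocks. i \<in> B \<and> card B = 2"
      using blocks_through[of i] by simp_all
  next
    fix i j assume "i \<in> {..<9::nat}" "j \<in> {..<9}" "i \<noteq> j"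
    then show "\<exists>B\<in>blocks. i \<in> B \<and> j \<in> B" using blocks_pair[of i j] by simp
  next
    fix B B' i j assume "B \<in> blocks" "B' \<in> blocks" "i \<in> B" "j \<in> B" "i \<in> B'" "j \<in> B'" "i \<noteq> j"
    then show "B = B'" by (rule blocks_unique)
  qed (simp_all add: blocks_card)
  obtain x y w a a' b b' c c' where d: "distinct [x, y, w, a, a', b, b', c, c']"
    and V: "{..<9} = {x, y, w, a, a', b, b', c, c'}"
    and B: "{y, w, a, a'} \<in> blocks" "{w, x, b, b'} \<in> blocks" "{x, y, c, c'} \<in> blocks"
      "{a, b, c} \<in> blocks" "{a, b', c'} \<in> blocks" "{a', b, c'} \<in> blocks" "{a', b', c} \<in> blocks"
    by (rule design.B3_configuration)
  have "x \<in> {..<9}" "y \<in> {..<9}" "w \<in> {..<9}" "a \<in> {..<9}" "a' \<in> {..<9}" "b \<in> {..<9}" "b' \<in> {..<9}"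
    "c \<in> {..<9}" "c' \<in> {..<9}" unfolding V by simp_all
  then have lt: "x < 9" "y < 9" "w < 9" "a < 9" "a' < 9" "b < 9" "b' < 9" "c < 9" "c' < 9" by simp_all
  have ne: "x \<noteq> y" "w \<noteq> x" "y \<noteq> w" "w \<notin> {x, y, c, c'}" "y \<noteq> a" "w \<noteq> a" "y \<noteq> a'" "w \<noteq> a'"
     "w \<noteq> b" "x \<noteq> b" "w \<noteq> b'" "x \<noteq> b'" "x \<noteq> c" "y \<noteq> c" "x \<noteq> c'" "y \<noteq> c'" "c \<noteq> c'"
     "a \<noteq> b" "a \<noteq> b'" "a' \<noteq> b" "a' \<noteq> b'"
    using d by auto
  have d0: "det3 (L x) (L y) (L w) \<noteq> 0"
    using concurrent[OF B(3), of x y w] ne lt by simp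
  have da: "det3 (L y) (L w) (L a) = 0" "det3 (L y) (L w) (L a') = 0"
    using concurrent[OF B(1), of y w] ne lt by simp_all
  have db: "det3 (L w) (L x) (L b) = 0" "det3 (L w) (L x) (L b') = 0"
    using concurrent[OF B(2), of w x] ne lt by simp_all
  have dc: "det3 (L x) (L y) (L c) = 0" "det3 (L x) (L y) (L c') = 0"
    using concurrent[OF B(3), of x y] ne lt by simp_all
  have dt: "det3 (L a) (L b) (L c) = 0" "det3 (L a) (L b') (L c') = 0"
    "det3 (L a') (L b) (L c') = 0" "det3 (L a') (L b') (L c) = 0"
    using concurrent[OF B(4), of a b c] concurrent[OF B(5), of a b' c']
      concurrent[OF B(6), of a' b c'] concurrent[OF B(7), of a' b' c] ne lt by simp_all
  note np = nonprop[OF lt(2) lt(4) ne(5)] nonprop[OF lt(3) lt(4) ne(6)]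
    nonprop[OF lt(2) lt(5) ne(7)] nonprop[OF lt(3) lt(5) ne(8)]
    nonprop[OF lt(3) lt(6) ne(9)] nonprop[OF lt(1) lt(6) ne(10)]
    nonprop[OF lt(3) lt(7) ne(11)] nonprop[OF lt(1) lt(7) ne(12)]
    nonprop[OF lt(1) lt(8) ne(13)] nonprop[OF lt(2) lt(8) ne(14)]
    nonprop[OF lt(1) lt(9) ne(15)] nonprop[OF lt(2) lt(9) ne(16)] nonprop[OF lt(8) lt(9) ne(17)]
  obtain X Y W where XYW: "det3 X Y W \<noteq> 0"
    "proportional (L x) X" "proportional (L y) Y" "proportional (L w) W"
    "proportional (L a) (Y - W)" "proportional (L a') (Y + W)" "proportional (L b) (W - X)"
    "proportional (L b') (W + X)" "proportional (L c) (X - Y)" "proportional (L c') (X + Y)"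
    by (rule B3_normal_form[OF d0 da(1) np(1,2) da(2) np(3,4) db(1) np(5,6) db(2) np(7,8)
          dc(1) np(9,10) dc(2) np(11-13) dt])
  have "dotc f (Z v) = 0" if "proportional (L i) f" "i < 9" "dotc f v = 0" for f v i
    using that inv[of i v] by (auto simp: proportional_def dotc_linear)
  note inv' = this
  show thesis
  proof (rule that[OF XYW(1)])
    fix f v assume f: "f \<in> {X, Y, W, Y - W, Y + W, W - X, W + X, X - Y, X + Y}" "dotc f v = 0"
    from f(1) obtain i where "proportional (L i) f" "i < 9"
      using XYW(2-10) lt unfolding insert_iff empty_iff by metis
    then show "dotc f (Z v) = 0" using inv' f(2) by blast
  qed
qed

lemma quadratic_zero:
  assumes "\<And>r::complex. a + b * r + c * r\<^sup>2 = 0"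
  shows "a = 0" "b = 0" "c = 0"
proof -
  have "poly [:a, b, c:] r = 0" for r
    using assms[of r] by (simp add: algebra_simps power2_eq_square)
  then have "[:a, b, c:] = 0" using poly_all_0_iff_0 by blast
  then show "a = 0" "b = 0" "c = 0" by simp_all
qed

definition cubic_form :: "(complex \<Rightarrow> complex \<Rightarrow> complex \<Rightarrow> complex) \<Rightarrow> bool" where
  "cubic_form f \<longleftrightarrow> (\<exists>c1 c2 c3 c4 c5 c6 c7 c8 c9 c10. \<forall>p q r. f p q r =
     c1 * p^3 + c2 * q^3 + c3 * r^3 + c4 * p^2 * q + c5 * p^2 * r + c6 * q^2 * p + c7 * q^2 * r
     + c8 * r^2 * p + c9 * r^2 * q + c10 * p * q * r)"

lemma cubic_form_rotate: assumes "cubic_form f" shows "cubic_form (\<lambda>p q r. f r p q)"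
proof -
  obtain c1 c2 c3 c4 c5 c6 c7 c8 c9 c10 where f: "\<And>p q r. f p q r =
     c1 * p^3 + c2 * q^3 + c3 * r^3 + c4 * p^2 * q + c5 * p^2 * r + c6 * q^2 * p + c7 * q^2 * r
     + c8 * r^2 * p + c9 * r^2 * q + c10 * p * q * r"
    using assms unfolding cubic_form_def by metis
  show ?thesis unfolding cubic_form_def
    by (rule exI[of _ c2], rule exI[of _ c3], rule exI[of _ c1], rule exI[of _ c7], rule exI[of _ c6],
        rule exI[of _ c9], rule exI[of _ c8], rule exI[of _ c4], rule exI[of _ c5], rule exI[of _ c10])
       (simp add: f algebra_simps)
qed

lemma cubic_form_factor:
  assumes "cubic_form f" "\<And>q r. f 0 q r = 0"
  obtains a1 a2 a3 a4 a5 a6 where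
    "\<And>p q r. f p q r = p * (a1 * p^2 + a2 * q^2 + a3 * r^2 + a4 * p * q + a5 * p * r + a6 * q * r)"
proof -
  obtain c1 c2 c3 c4 c5 c6 c7 c8 c9 c10 where f: "\<And>p q r. f p q r =
     c1 * p^3 + c2 * q^3 + c3 * r^3 + c4 * p^2 * q + c5 * p^2 * r + c6 * q^2 * p + c7 * q^2 * r
     + c8 * r^2 * p + c9 * r^2 * q + c10 * p * q * r"
    using assms unfolding cubic_form_def by metis
  have c3: "c3 = 0" using assms(2)[of 0 1] by (simp add: f)
  have "c2 + c7 * r + c9 * r\<^sup>2 = 0" for r
    using assms(2)[of 1 r] c3 by (simp add: f algebra_simps)
  from quadratic_zero[OF this] have "c2 = 0" "c7 = 0" "c9 = 0" .
  then have "f p q r = p * (c1 * p^2 + c6 * q^2 + c8 * r^2 + c4 * p * q + c5 * p * r + c10 * q * r)" for p q r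
    by (simp add: f c3 algebra_simps power2_eq_square power3_eq_cube)
  then show thesis using that by blast
qed

text \<open>A quadratic form in \<open>p\<close>, \<open>q\<close>, \<open>r\<close> with coefficients \<open>d1, ..., d6\<close> of \<open>p\<^sup>2, q\<^sup>2, r\<^sup>2, p q, p r, q r\<close> that vanishes at
  all \<open>(1, 1, r)\<close> and \<open>(1, -1, r)\<close> is a multiple of \<open>p\<^sup>2 - q\<^sup>2\<close>.\<close>
lemma difference_of_squares:
  fixes d1 :: complex
  assumes "\<And>r. (d1 + d2 + d4) + (d5 + d6) * r + d3 * r\<^sup>2 = 0"
    "\<And>r. (d1 + d2 - d4) + (d5 - d6) * r + d3 * r\<^sup>2 = 0"
  shows "d2 = - d1" "d3 = 0" "d4 = 0" "d5 = 0" "d6 = 0"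
proof -
  note 1 = quadratic_zero[OF assms(1)] and 2 = quadratic_zero[OF assms(2)]
  have "2 * d4 = (d1 + d2 + d4) - (d1 + d2 - d4)" by simp
  then show d4: "d4 = 0" using 1 2 by simp
  have "2 * d6 = (d5 + d6) - (d5 - d6)" by simp
  then show "d6 = 0" using 1 2 by simp
  then show "d5 = 0" using 1 by simp
  show "d3 = 0" by (rule 1)
  show "d2 = - d1" using 1(1) d4 by (simp add: eq_neg_iff_add_eq_0 add.commute)
qed

text \<open>Invariance of the coordinate planes gives \<open>P = p A\<close>, \<open>Q = q B\<close>, \<open>R = r C\<close>.  Invariance of \<open>p = q\<close> and
  \<open>p = - q\<close> makes \<open>A - B\<close> a multiple of \<open>p\<^sup>2 - q\<^sup>2\<close>, and likewise for the other pairs.  The three differences add up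
  to zero, so the three multipliers agree.\<close>
lemma fermat_coefficients:
  assumes cub: "cubic_form P" "cubic_form Q" "cubic_form R"
    and z: "\<And>q r. P 0 q r = 0" "\<And>p r. Q p 0 r = 0" "\<And>p q. R p q 0 = 0"
    and PQ: "\<And>p r. P p p r = Q p p r" "\<And>p r. P p (-p) r = - Q p (-p) r"
    and QR: "\<And>p q. Q p q q = R p q q" "\<And>p q. Q p q (-q) = - R p q (-q)"
    and RP: "\<And>p q. R p q p = P p q p" "\<And>p q. R p q (-p) = - P p q (-p)"
  obtains \<gamma> where "\<And>p q r. Q p q r * r - R p q r * q = \<gamma> * (q * r * (q\<^sup>2 - r\<^sup>2))"
    "\<And>p q r. R p q r * p - P p q r * r = \<gamma> * (p * r * (r\<^sup>2 - p\<^sup>2))"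
    "\<And>p q r. P p q r * q - Q p q r * p = \<gamma> * (p * q * (p\<^sup>2 - q\<^sup>2))"
proof -
  obtain a1 a2 a3 a4 a5 a6 where P:
    "\<And>p q r. P p q r = p * (a1 * p^2 + a2 * q^2 + a3 * r^2 + a4 * p * q + a5 * p * r + a6 * q * r)"
    using cubic_form_factor[OF cub(1) z(1)] by blast
  obtain b2 b3 b1 b6 b4 b5 where Q0:
    "\<And>q r p. Q p q r = q * (b2 * q^2 + b3 * r^2 + b1 * p^2 + b6 * q * r + b4 * q * p + b5 * r * p)"
    using cubic_form_factor[OF cubic_form_rotate[OF cub(2)] z(2)] by blast
  obtain c3 c1 c2 c5 c6 c4 where R0:
    "\<And>r p q. R p q r = r * (c3 * r^2 + c1 * p^2 + c2 * q^2 + c5 * r * p + c6 * r * q + c4 * p * q)"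
    using cubic_form_factor[OF cubic_form_rotate[OF cubic_form_rotate[OF cub(3)]] z(3)] by blast
  have "((a1 - b1) + (a2 - b2) + (a4 - b4)) + ((a5 - b5) + (a6 - b6)) * r + (a3 - b3) * r\<^sup>2 = 0"
    "((a1 - b1) + (a2 - b2) - (a4 - b4)) + ((a5 - b5) - (a6 - b6)) * r + (a3 - b3) * r\<^sup>2 = 0" for r
    using PQ(1)[of 1 r] PQ(2)[of 1 r] by (simp_all add: P Q0 algebra_simps)
  note AB = difference_of_squares[OF this]
  have "((b2 - c2) + (b3 - c3) + (b6 - c6)) + ((b4 - c4) + (b5 - c5)) * p + (b1 - c1) * p\<^sup>2 = 0"
    "((b2 - c2) + (b3 - c3) - (b6 - c6)) + ((b4 - c4) - (b5 - c5)) * p + (b1 - c1) * p\<^sup>2 = 0" for p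
    using QR(1)[of p 1] QR(2)[of p 1] by (simp_all add: Q0 R0 algebra_simps)
  note BC = difference_of_squares[OF this]
  have "((c3 - a3) + (c1 - a1) + (c5 - a5)) + ((c4 - a4) + (c6 - a6)) * q + (c2 - a2) * q\<^sup>2 = 0"
    "((c3 - a3) + (c1 - a1) - (c5 - a5)) + ((c4 - a4) - (c6 - a6)) * q + (c2 - a2) * q\<^sup>2 = 0" for q
    using RP(1)[of 1 q] RP(2)[of 1 q] by (simp_all add: R0 P algebra_simps)
  note CA = difference_of_squares[OF this]
  define \<gamma> where "\<gamma> = a1 - b1"
  have ab: "a1 = b1 + \<gamma>" "a2 = b2 - \<gamma>" "a3 = b3" "a4 = b4" "a5 = b5" "a6 = b6"
    using AB by (simp_all add: \<gamma>_def algebra_simps)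
  have bc: "c1 = b1" "c4 = b4" "c5 = b5" "c6 = b6" using BC by simp_all
  have c2: "c2 = b2 - \<gamma>" using CA(2) ab by simp
  have c3: "c3 = b3 + \<gamma>" using BC(1) c2 by (simp add: algebra_simps)
  show thesis
    by (rule that[of \<gamma>]; simp add: P Q0 R0 ab bc c2 c3 algebra_simps power2_eq_square)
qed

section \<open>Evaluation of polynomials in three variables\<close>

definition ev :: "poly3 \<Rightarrow> complex ^ 3 \<Rightarrow> complex" where
  "ev p v = poly (poly (poly p [:[:v $ 3:]:]) [:v $ 2:]) (v $ 1)"

lemma ev_simps [simp]:
  "ev (p + q) v = ev p v + ev q v" "ev (p - q) v = ev p v - ev q v" "ev (- p) v = - ev p v"
  "ev (p * q) v = ev p v * ev q v" "ev 0 v = 0" "ev 1 v = 1" "ev (const3 c) v = c"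
  "ev (p ^ n) v = ev p v ^ n"
  by (simp_all add: ev_def const3_def)

lemma ev_sum: "ev (sum f S) v = (\<Sum>i\<in>S. ev (f i) v)"
  by (induction S rule: infinite_finite_induct) auto

lemma ev_prod_list: "ev (prod_list ps) v = (\<Prod>i<length ps. ev (ps ! i) v)"
proof -
  have "ev (prod_list ps) v = prod_list (map (\<lambda>p. ev p v) ps)" by (induction ps) auto
  also have "\<dots> = (\<Prod>i<length ps. ev (ps ! i) v)"
    by (subst prod.list_conv_set_nth) (auto simp: atLeast0LessThan)
  finally show ?thesis .
qed

lemma ev_coords [simp]: "ev (coords $ i) v = v $ i"
  using exhaust_3[of i] by (auto simp: coords_def ev_def)

text \<open>Polynomial identities may be checked pointwise, which lets the geometry be done with functions on \<open>\<complex>\<^sup>3\<close>.\<close>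
lemma ev_eqI:
  assumes "\<And>v. ev p v = ev q v" shows "p = q"
proof -
  have const_zero: "r = 0" if "\<And>c. poly r (f c) = 0" "inj f" for r :: "'a :: idom poly" and f :: "complex \<Rightarrow> 'a"
  proof (rule ccontr)
    assume "r \<noteq> 0"
    then have "finite {s. poly r s = 0}" by (rule poly_roots_finite)
    then have "finite (range f)" by (rule rev_finite_subset) (use that(1) in auto)
    then show False using finite_imageD[OF _ that(2)] infinite_UNIV_char_0 by blast
  qed
  define r where "r = p - q"
  have "poly (poly (poly r [:[:z:]:]) [:y:]) x = 0" for x y z
    using assms[of "vector [x, y, z]"] by (simp add: r_def ev_def)
  then have "poly (poly r [:[:z:]:]) [:y:] = 0" for y z
    using poly_all_0_iff_0 by blast
  then have "poly r [:[:z:]:] = 0" for z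
    by (intro const_zero[of _ "\<lambda>y. [:y:]"]) (auto simp: inj_def)
  then have "r = 0"
    by (intro const_zero[of _ "\<lambda>z. [:[:z:]:]"]) (auto simp: inj_def)
  then show ?thesis by (simp add: r_def)
qed

lemma ev_subst3: "ev (subst3 \<phi> p) v = ev p (\<chi> i. ev (\<phi> $ i) v)"
proof -
  have 1: "ev (poly (map_poly const3 r) (\<phi> $ 1)) v = poly r (ev (\<phi> $ 1) v)" for r
  proof (induction r)
    case (pCons a r)
    have "const3 0 = 0" by (simp add: const3_def)
    then show ?case by (simp add: map_poly_pCons pCons.IH)
  qed simp
  have 2: "ev (poly (map_poly (\<lambda>r. poly (map_poly const3 r) (\<phi> $ 1)) q) (\<phi> $ 2)) v
      = poly (poly q [:ev (\<phi> $ 2) v:]) (ev (\<phi> $ 1) v)" for q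
    by (induction q) (simp_all add: map_poly_pCons 1)
  show ?thesis unfolding subst3_def ev_def[of p]
    by (induction p) (simp_all add: map_poly_pCons 2)
qed

abbreviation cf :: "poly3 \<Rightarrow> nat \<Rightarrow> nat \<Rightarrow> nat \<Rightarrow> complex" where
  "cf p i j k \<equiv> coeff (coeff (coeff p k) j) i"

lemma cf_zero: "homogeneous n p \<Longrightarrow> i + j + k \<noteq> n \<Longrightarrow> cf p i j k = 0"
  unfolding homogeneous_def by blast

lemma poly3_eqI: "(\<And>i j k. cf p i j k = cf q i j k) \<Longrightarrow> p = q"
  by (intro poly_eqI) blast

definition linear_coeffs :: "poly3 \<Rightarrow> complex ^ 3" where
  "linear_coeffs l = vector [cf l 1 0 0, cf l 0 1 0, cf l 0 0 1]"

definition linear_poly :: "complex ^ 3 \<Rightarrow> poly3" where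
  "linear_poly u = [:[:[:0, u $ 1:], [:u $ 2:]:], [:[:u $ 3:]:]:]"

lemma homogeneous1: "homogeneous 1 l \<Longrightarrow> l = linear_poly (linear_coeffs l)"
  by (rule poly3_eqI)
    (auto simp: linear_poly_def linear_coeffs_def coeff_pCons cf_zero numeral_2_eq_2 split: nat.split)

lemma ev_linear: "ev (linear_poly u) v = dotc u v"
  by (simp add: ev_def linear_poly_def dotc_def algebra_simps)

lemma pdiff_linear: "pdiff i (linear_poly u) = const3 (u $ i)"
  using exhaust_3[of i]
  by (auto simp: pdiff_def linear_poly_def const3_def pderiv_pCons map_poly_pCons)

lemma homogeneous3:
  assumes "homogeneous 3 p"
  shows "p = [: [: [:0, 0, 0, cf p 3 0 0:], [:0, 0, cf p 2 1 0:], [:0, cf p 1 2 0:], [:cf p 0 3 0:] :],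
     [: [:0, 0, cf p 2 0 1:], [:0, cf p 1 1 1:], [:cf p 0 2 1:] :],
     [: [:0, cf p 1 0 2:], [:cf p 0 1 2:] :], [:[:cf p 0 0 3:]:] :]"
  using cf_zero[OF assms]
  by (intro poly3_eqI) (auto simp: coeff_pCons eval_nat_numeral split: nat.split)

text \<open>The symmetric trilinear form of a homogeneous cubic: each monomial is replaced by the average over the
  ways to distribute its three factors among \<open>u\<close>, \<open>v\<close>, \<open>w\<close>.\<close>
definition polar :: "poly3 \<Rightarrow> complex ^ 3 \<Rightarrow> complex ^ 3 \<Rightarrow> complex ^ 3 \<Rightarrow> complex" where
  "polar p u v w =
     cf p 3 0 0 * (u $ 1 * v $ 1 * w $ 1) + cf p 0 3 0 * (u $ 2 * v $ 2 * w $ 2) + cf p 0 0 3 * (u $ 3 * v $ 3 * w $ 3)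
   + cf p 2 1 0 / 3 * (u $ 1 * v $ 1 * w $ 2 + u $ 1 * v $ 2 * w $ 1 + u $ 2 * v $ 1 * w $ 1)
   + cf p 2 0 1 / 3 * (u $ 1 * v $ 1 * w $ 3 + u $ 1 * v $ 3 * w $ 1 + u $ 3 * v $ 1 * w $ 1)
   + cf p 1 2 0 / 3 * (u $ 2 * v $ 2 * w $ 1 + u $ 2 * v $ 1 * w $ 2 + u $ 1 * v $ 2 * w $ 2)
   + cf p 0 2 1 / 3 * (u $ 2 * v $ 2 * w $ 3 + u $ 2 * v $ 3 * w $ 2 + u $ 3 * v $ 2 * w $ 2)
   + cf p 1 0 2 / 3 * (u $ 3 * v $ 3 * w $ 1 + u $ 3 * v $ 1 * w $ 3 + u $ 1 * v $ 3 * w $ 3)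
   + cf p 0 1 2 / 3 * (u $ 3 * v $ 3 * w $ 2 + u $ 3 * v $ 2 * w $ 3 + u $ 2 * v $ 3 * w $ 3)
   + cf p 1 1 1 / 6 * (u $ 1 * v $ 2 * w $ 3 + u $ 1 * v $ 3 * w $ 2 + u $ 2 * v $ 1 * w $ 3
                     + u $ 2 * v $ 3 * w $ 1 + u $ 3 * v $ 1 * w $ 2 + u $ 3 * v $ 2 * w $ 1)"

lemma ev_cubic: "homogeneous 3 p \<Longrightarrow> ev p v = polar p v v v"
  by (subst homogeneous3, assumption, unfold ev_def polar_def) (simp add: algebra_simps)

lemma ev_pdiff_cubic:
  assumes "homogeneous 3 p"
  shows "(\<Sum>j\<in>UNIV. w $ j * ev (pdiff j p) v) = 3 * polar p v v w"
proof -
  have 1: "ev (pdiff 1 p) v = 3 * polar p v v (axis 1 1)"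
    by (subst homogeneous3[OF assms], unfold ev_def polar_def pdiff_def)
      (simp add: pderiv_pCons map_poly_pCons axis_def algebra_simps)
  have 2: "ev (pdiff 2 p) v = 3 * polar p v v (axis 2 1)"
    by (subst homogeneous3[OF assms], unfold ev_def polar_def pdiff_def)
      (simp add: pderiv_pCons map_poly_pCons axis_def algebra_simps)
  have 3: "ev (pdiff 3 p) v = 3 * polar p v v (axis 3 1)"
    by (subst homogeneous3[OF assms], unfold ev_def polar_def pdiff_def)
      (simp add: pderiv_pCons map_poly_pCons axis_def algebra_simps)
  show ?thesis by (simp add: sum_3 1 2 3) (simp add: polar_def axis_def algebra_simps)
qed

definition polar_field :: "poly3 ^ 3 \<Rightarrow> complex ^ 3 \<Rightarrow> complex ^ 3 \<Rightarrow> complex ^ 3 \<Rightarrow> complex ^ 3" where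
  "polar_field Z u v w = (\<chi> m. polar (Z $ m) u v w)"

lemma cubic_field_polar: "cubic_field (polar_field Z)"
  by unfold_locales (simp_all add: polar_field_def vec_eq_iff polar_def algebra_simps)

definition evv :: "poly3 ^ 3 \<Rightarrow> complex ^ 3 \<Rightarrow> complex ^ 3" where
  "evv \<Omega> v = (\<chi> i. ev (\<Omega> $ i) v)"

lemma Z_polar: "(\<And>i. homogeneous 3 (Z $ i)) \<Longrightarrow> cubic_field.Z (polar_field Z) v = evv Z v"
  by (simp add: cubic_field.Z_def[OF cubic_field_polar] polar_field_def ev_cubic evv_def)

lemma const3_0_1: "const3 0 = 0" "const3 1 = 1"
  by (simp_all add: const3_def one_pCons)

lemma derivation_coords: "derivation Z (coords $ i) = Z $ i"
proof -
  have "coords $ i = linear_poly (axis i 1)"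
    using exhaust_3[of i] by (auto simp: coords_def linear_poly_def axis_def one_pCons)
  then show ?thesis
    using exhaust_3[of i] const3_0_1 by (auto simp: derivation_def pdiff_linear sum_3 axis_def)
qed

lemma ev_inflection:
  assumes "\<And>i. homogeneous 3 (Z $ i)"
  shows "ev (inflection_poly Z) v = cubic_field.infl (polar_field Z) v"
proof -
  interpret cubic_field "polar_field Z" by (rule cubic_field_polar)
  have 1: "ev (derivation Z (Z $ i)) v = D v (evv Z v) $ i" for i
    using ev_pdiff_cubic[OF assms, of "evv Z v"]
    by (simp add: derivation_def ev_sum D_def polar_field_def evv_def)
  show ?thesis
    unfolding infl_def Z_polar[OF assms] inflection_poly_def det_3 derivation_coords
    by (simp add: 1 vec3_simps evv_def algebra_simps)
qed

lemma ev_form_of_field: "evv (form_of_field Z) v = crossc (evv Z v) v"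
  by (simp add: evv_def form_of_field_def vec_eq_iff forall_3 det_3 axis_def crossc_nth algebra_simps)

section \<open>From the foliation to the Fermat form\<close>

lemma crossc_dotc_crossc: "dotc (crossc a b) (crossc u v) = dotc u a * dotc v b - dotc v a * dotc u b"
  by (simp add: vec3_simps algebra_simps)

lemma dual_cramer:
  "det3 x y w *s v = dotc x v *s crossc y w + dotc y v *s crossc w x + dotc w v *s crossc x y"
  by (simp add: vec3_simps algebra_simps)

lemma cramer_dual:
  "det3 x y w *s u = dotc u (crossc y w) *s x + dotc u (crossc w x) *s y + dotc u (crossc x y) *s w"
  by (simp add: vec3_simps algebra_simps)

lemma crossc_eq_0I:
  assumes "\<And>j k. l $ j * u $ k - l $ k * u $ j = 0" shows "crossc l u = 0"
  using assms[of 2 3] assms[of 3 1] assms[of 1 2] by (simp add: vec_eq_iff forall_3)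

context cubic_field begin

lemma infl_scale: "infl (s *s v) = s ^ 9 * infl v"
proof -
  have "D (s *s v) u = s\<^sup>2 *s D v u" for u
    by (simp add: D_def T_scale vector_smult_assoc power2_eq_square mult.commute)
  then show ?thesis
    by (simp add: infl_def Z_scale D_scale det3_linear eval_nat_numeral)
qed

lemma fermat_in_coordinates:
  assumes d: "det3 x y w \<noteq> 0"
    and inv: "\<And>f v. f \<in> {x, y, w, y - w, y + w, w - x, w + x, x - y, x + y} \<Longrightarrow> dotc f v = 0 \<Longrightarrow> dotc f (Z v) = 0"
  obtains \<gamma> where
    "\<And>v. dotc y (Z v) * dotc w v - dotc w (Z v) * dotc y v = \<gamma> * (dotc y v * dotc w v * ((dotc y v)\<^sup>2 - (dotc w v)\<^sup>2))"
    "\<And>v. dotc w (Z v) * dotc x v - dotc x (Z v) * dotc w v = \<gamma> * (dotc x v * dotc w v * ((dotc w v)\<^sup>2 - (dotc x v)\<^sup>2))"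
    "\<And>v. dotc x (Z v) * dotc y v - dotc y (Z v) * dotc x v = \<gamma> * (dotc x v * dotc y v * ((dotc x v)\<^sup>2 - (dotc y v)\<^sup>2))"
proof -
  define e1 where "e1 = (1 / det3 x y w) *s crossc y w"
  define e2 where "e2 = (1 / det3 x y w) *s crossc w x"
  define e3 where "e3 = (1 / det3 x y w) *s crossc x y"
  define E where "E p q r = p *s e1 + q *s e2 + r *s e3" for p q r
  have dd: "det3 x y w = dotc x (crossc y w)" "det3 x y w = dotc y (crossc w x)" "det3 x y w = dotc w (crossc x y)"
    by (simp_all add: vec3_simps algebra_simps)
  have E: "dotc x (E p q r) = p" "dotc y (E p q r) = q" "dotc w (E p q r) = r" for p q r
    using d by (simp_all add: E_def e1_def e2_def e3_def dotc_linear flip: dd)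
  have v: "v = E (dotc x v) (dotc y v) (dotc w v)" for v
  proof -
    have "v = (1 / det3 x y w) *s (det3 x y w *s v)" using d by (simp add: vector_smult_assoc)
    also have "\<dots> = E (dotc x v) (dotc y v) (dotc w v)"
      unfolding dual_cramer by (simp add: E_def e1_def e2_def e3_def vec_eq_iff algebra_simps)
    finally show ?thesis .
  qed
  have cubic: "cubic_form (\<lambda>p q r. dotc f (Z (E p q r)))" for f
    unfolding cubic_form_def
    by (rule exI[of _ "dotc f (T e1 e1 e1)"], rule exI[of _ "dotc f (T e2 e2 e2)"], rule exI[of _ "dotc f (T e3 e3 e3)"],
        rule exI[of _ "3 * dotc f (T e1 e1 e2)"], rule exI[of _ "3 * dotc f (T e1 e1 e3)"],
        rule exI[of _ "3 * dotc f (T e1 e2 e2)"], rule exI[of _ "3 * dotc f (T e2 e2 e3)"],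
        rule exI[of _ "3 * dotc f (T e1 e3 e3)"], rule exI[of _ "3 * dotc f (T e2 e3 e3)"],
        rule exI[of _ "6 * dotc f (T e1 e2 e3)"])
      (simp only: Z_def E_def T_add T_scale dotc_linear, simp add: T_commute algebra_simps power2_eq_square power3_eq_cube)
  show thesis
  proof (rule fermat_coefficients[OF cubic[of x] cubic[of y] cubic[of w]])
    have i: "dotc x (Z v) = 0" if "dotc x v = 0" for v using inv[of x] that by simp
    show "dotc x (Z (E 0 q r)) = 0" for q r by (rule i) (simp add: E)
    have i: "dotc y (Z v) = 0" if "dotc y v = 0" for v using inv[of y] that by simp
    show "dotc y (Z (E p 0 r)) = 0" for p r by (rule i) (simp add: E)
    have i: "dotc w (Z v) = 0" if "dotc w v = 0" for v using inv[of w] that by simp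
    show "dotc w (Z (E p q 0)) = 0" for p q by (rule i) (simp add: E)
    have i: "dotc x (Z v) = dotc y (Z v)" if "dotc x v = dotc y v" for v
      using inv[of "x - y" v] that by (simp add: dotc_linear)
    show "dotc x (Z (E p p r)) = dotc y (Z (E p p r))" for p r by (rule i) (simp add: E)
    have i: "dotc x (Z v) = - dotc y (Z v)" if "dotc x v = - dotc y v" for v
      using inv[of "x + y" v] that by (simp add: dotc_linear eq_neg_iff_add_eq_0)
    show "dotc x (Z (E p (- p) r)) = - dotc y (Z (E p (- p) r))" for p r by (rule i) (simp add: E)
    have i: "dotc y (Z v) = dotc w (Z v)" if "dotc y v = dotc w v" for v
      using inv[of "y - w" v] that by (simp add: dotc_linear)
    show "dotc y (Z (E p q q)) = dotc w (Z (E p q q))" for p q by (rule i) (simp add: E)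
    have i: "dotc y (Z v) = - dotc w (Z v)" if "dotc y v = - dotc w v" for v
      using inv[of "y + w" v] that by (simp add: dotc_linear eq_neg_iff_add_eq_0)
    show "dotc y (Z (E p q (- q))) = - dotc w (Z (E p q (- q)))" for p q by (rule i) (simp add: E)
    have i: "dotc w (Z v) = dotc x (Z v)" if "dotc w v = dotc x v" for v
      using inv[of "w - x" v] that by (simp add: dotc_linear)
    show "dotc w (Z (E p q p)) = dotc x (Z (E p q p))" for p q by (rule i) (simp add: E)
    have i: "dotc w (Z v) = - dotc x (Z v)" if "dotc w v = - dotc x v" for v
      using inv[of "w + x" v] that by (simp add: dotc_linear eq_neg_iff_add_eq_0)
    show "dotc w (Z (E p q (- p))) = - dotc x (Z (E p q (- p)))" for p q by (rule i) (simp add: E)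
    fix \<gamma>
    assume \<gamma>: "\<And>p q r. dotc y (Z (E p q r)) * r - dotc w (Z (E p q r)) * q = \<gamma> * (q * r * (q\<^sup>2 - r\<^sup>2))"
      "\<And>p q r. dotc w (Z (E p q r)) * p - dotc x (Z (E p q r)) * r = \<gamma> * (p * r * (r\<^sup>2 - p\<^sup>2))"
      "\<And>p q r. dotc x (Z (E p q r)) * q - dotc y (Z (E p q r)) * p = \<gamma> * (p * q * (p\<^sup>2 - q\<^sup>2))"
    show thesis
      by (rule that[of \<gamma>]) (use \<gamma>[of "dotc x v" "dotc y v" "dotc w v" for v, folded v] in blast)+
  qed
qed

end

text \<open>Two fields with the same 1-form differ at each point by a multiple of the radial vector.  Differentiating the
  identity of the forms along \<open>Z v\<close> exchanges one derivative for the other inside the determinant, and the radial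
  multiple is removed by a column operation.\<close>
lemma infl_eq_of_same_form:
  assumes "cubic_field T" "cubic_field T'"
    and "\<And>v. crossc (cubic_field.Z T v) v = crossc (cubic_field.Z T' v) v"
  shows "cubic_field.infl T v = cubic_field.infl T' v"
proof -
  interpret a: cubic_field T by (rule assms)
  interpret b: cubic_field T' by (rule assms)
  show ?thesis
  proof (cases "v = 0")
    case True
    then show ?thesis by (simp add: a.infl_def b.infl_def det3_linear)
  next
    case False
    have "crossc (a.Z v - b.Z v) v = 0" using assms(3) by (simp add: crossc_linear)
    then have "crossc v (a.Z v - b.Z v) = 0" using crossc_anti[of v] by simp
    then obtain s where "a.Z v - b.Z v = s *s v" using crossc_eq_0D False by blast
    then have Z: "a.Z v = b.Z v - (- s) *s v" by (simp add: algebra_simps)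
    define e where "e = a.Z v"
    obtain P where P: "coeff P 1 = det3 e e (a.Z v) + det3 e v (a.D v e)"
      "\<And>s. poly P s = det3 e (v + s *s e) (a.Z (v + s *s e))"
      using a.quartic_on_line[of e v e] by metis
    obtain Q where Q: "coeff Q 1 = det3 e e (b.Z v) + det3 e v (b.D v e)"
      "\<And>s. poly Q s = det3 e (v + s *s e) (b.Z (v + s *s e))"
      using b.quartic_on_line[of e v e] by metis
    have "det3 e q (a.Z q) = det3 e q (b.Z q)" for q
      using assms(3)[of q] crossc_anti[of q] by (simp add: det3_def)
    then have "poly P = poly Q" by (simp add: fun_eq_iff P Q)
    then have "P = Q" by (simp add: poly_eq_poly_eq_iff)
    then have "det3 e v (a.D v e) = det3 e v (b.D v e)" using P(1) Q(1) by (simp add: det3_linear)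
    then have "a.infl v = det3 v e (b.D v e)"
      by (simp add: a.infl_def e_def det3_swap[of v])
    also have "\<dots> = b.infl v" using b.infl_shift[of v "- s"] by (simp add: e_def Z)
    finally show ?thesis .
  qed
qed

text \<open>The number of lines is found by comparing degrees, the determinant being homogeneous of degree \<open>1 + 3 + 5\<close>.
  Two proportional lines give a square factor of the inflection polynomial.\<close>
lemma nine_lines_of_convex:
  assumes hom: "\<And>i. homogeneous 3 (Z $ i)"
    and prod: "product_of_invariant_lines (form_of_field Z) (inflection_poly Z)"
    and sqf: "squarefree (inflection_poly Z)"
  obtains L c where "nine_lines (polar_field Z) L c"
proof -
  interpret F: cubic_field "polar_field Z" by (rule cubic_field_polar)
  obtain c ls where c: "c \<noteq> 0" and inv: "\<And>l. l \<in> set ls \<Longrightarrow> invariant_line (form_of_field Z) l"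
    and I: "inflection_poly Z = const3 c * prod_list ls"
    using prod unfolding product_of_invariant_lines_def by blast
  define L where "L i = linear_coeffs (ls ! i)" for i
  have lin: "ls ! i = linear_poly (L i)" if "i < length ls" for i
    using inv[of "ls ! i"] that by (simp add: invariant_line_def L_def homogeneous1)
  have nz: "L i \<noteq> 0" if "i < length ls" for i
  proof
    assume "L i = 0"
    then have "ls ! i = 0" using lin[OF that] by (simp add: linear_poly_def)
    then show False using inv[OF nth_mem[OF that]] by (simp add: invariant_line_def)
  qed
  have infl: "F.infl v = c * (\<Prod>i<length ls. dotc (L i) v)" for v
  proof -
    have "F.infl v = ev (inflection_poly Z) v" by (simp add: ev_inflection hom)
    also have "\<dots> = c * (\<Prod>i<length ls. ev (ls ! i) v)" by (simp add: I ev_prod_list)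
    also have "(\<Prod>i<length ls. ev (ls ! i) v) = (\<Prod>i<length ls. dotc (L i) v)"
      by (rule prod.cong) (simp_all add: lin ev_linear)
    finally show ?thesis .
  qed
  have len: "length ls = 9"
  proof -
    have "finite (L ` {..<length ls})" "0 \<notin> L ` {..<length ls}" using nz by auto
    then obtain v where v: "\<And>f. f \<in> L ` {..<length ls} \<Longrightarrow> dotc f v \<noteq> 0" using generic_vector by blast
    have "2 ^ 9 * F.infl v = 2 ^ length ls * F.infl v"
      using F.infl_scale[of 2 v] by (simp add: infl dotc_linear prod.distrib)
    moreover have "F.infl v \<noteq> 0" using v c by (auto simp: infl)
    ultimately have "(2::complex) ^ 9 = 2 ^ length ls" by simp
    then have "norm ((2::complex) ^ 9) = norm ((2::complex) ^ length ls)" by (rule arg_cong)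
    then have "(2::real) ^ 9 = 2 ^ length ls" unfolding norm_power by simp
    then show ?thesis using power_inject_exp[of "2::real" 9 "length ls"] by simp
  qed
  have nonprop: "crossc (L i) (L j) \<noteq> 0" if ij: "i < 9" "j < 9" "i \<noteq> j" for i j
  proof
    assume "crossc (L i) (L j) = 0"
    then obtain s where s: "L j = s *s L i" using crossc_eq_0D nz ij len by metis
    have "ls ! j = const3 s * ls ! i"
      by (rule ev_eqI) (simp add: lin len ij ev_linear s dotc_linear)
    then have "(ls ! i)\<^sup>2 dvd ls ! i * ls ! j" by (simp add: power2_eq_square algebra_simps)
    also have "ls ! i * ls ! j = (\<Prod>k\<in>{i, j}. ls ! k)" using ij by simp
    also have "\<dots> dvd (\<Prod>k<length ls. ls ! k)" using ij len by (intro prod_dvd_prod_subset) auto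
    also have "\<dots> = prod_list ls" by (subst prod.list_conv_set_nth) (auto simp: atLeast0LessThan)
    also have "\<dots> dvd inflection_poly Z" by (simp add: I)
    finally have "ls ! i dvd 1" using squarefreeD[OF sqf] by blast
    then obtain q where "1 = ls ! i * q" by (rule dvdE)
    then have "ev 1 0 = ev (ls ! i * q) 0" by simp
    then show False by (simp add: lin len ij ev_linear dotc_linear)
  qed
  have invL: "dotc (L i) (F.Z v) = 0" if i: "i < 9" "dotc (L i) v = 0" for i v
  proof (cases "v = 0")
    case True
    then show ?thesis using F.Z_scale[of 0 v] by (simp add: dotc_linear)
  next
    case False
    have "ev (pdiff j (ls ! i) * form_of_field Z $ k - pdiff k (ls ! i) * form_of_field Z $ j) v = 0" for j k
    proof -
      have "ls ! i dvd pdiff j (ls ! i) * form_of_field Z $ k - pdiff k (ls ! i) * form_of_field Z $ j"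
        using inv[of "ls ! i"] i len by (simp add: invariant_line_def)
      then obtain q where q: "pdiff j (ls ! i) * form_of_field Z $ k - pdiff k (ls ! i) * form_of_field Z $ j = ls ! i * q"
        by (rule dvdE)
      show ?thesis unfolding q using i(2) by (simp add: lin len i(1) ev_linear)
    qed
    then have "L i $ j * evv (form_of_field Z) v $ k - L i $ k * evv (form_of_field Z) v $ j = 0" for j k
      by (simp add: lin len i(1) pdiff_linear evv_def)
    then have "crossc (L i) (crossc (F.Z v) v) = 0"
      unfolding ev_form_of_field Z_polar[OF hom, symmetric] by (rule crossc_eq_0I)
    then have "dotc (L i) (F.Z v) *s v = 0" using i(2) by (simp add: crossc_crossc)
    then show ?thesis using False by simp
  qed
  have "nine_lines (polar_field Z) L c"
    by unfold_locales (use c nonprop invL infl len in auto)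
  then show thesis by (rule that)
qed

text \<open>The homogenization of the affine Fermat form of degree three.\<close>
definition fermat_form :: "poly3 ^ 3" where
  "fermat_form = (let x = coords $ 1; y = coords $ 2; z = coords $ 3 in
     vector [- (y * z * (y\<^sup>2 - z\<^sup>2)), - (x * z * (z\<^sup>2 - x\<^sup>2)), - (x * y * (x\<^sup>2 - y\<^sup>2))])"

lemma fermat_form_explicit:
  "fermat_form $ 1 = [:0, - [:0, 0, 0, 1:], 0, [:0, 1:]:]"
  "fermat_form $ 2 = [:0, [:[:0, 0, 0, 1:]:], 0, [:- [:0, 1:]:]:]"
  "fermat_form $ 3 = [:[:0, - [:0, 0, 0, 1:], 0, [:0, 1:]:]:]"
  by (simp_all add: fermat_form_def Let_def coords_def power2_eq_square algebra_simps)

text \<open>A common factor divides the third component, so it is free of \<open>z\<close>; by the \<open>z\<^sup>3\<close>-coefficient of the second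
  component it divides \<open>x\<close>, and by the first component it is free of \<open>x\<close> as well.\<close>
lemma fermat_foliation_form: "fermat_foliation 3 fermat_form"
proof -
  have hom: "homogeneous 4 (fermat_form $ i)" for i
    using exhaust_3[of i]
    by (elim disjE) (auto simp: fermat_form_explicit homogeneous_def coeff_pCons one_pCons eval_nat_numeral split: nat.splits)
  have "is_unit h" if h: "\<And>i. h dvd fermat_form $ i" for h
  proof -
    have "fermat_form $ 3 \<noteq> 0" by (simp add: fermat_form_explicit)
    then have "degree h \<le> degree (fermat_form $ 3)" by (rule dvd_imp_degree_le[OF h])
    then obtain h0 where h0: "h = [:h0:]" by (auto simp: fermat_form_explicit elim: degree_eq_zeroE)
    have "h0 dvd coeff (fermat_form $ 2) 3" using h[of 2] by (simp add: h0 const_poly_dvd_iff)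
    then have 2: "h0 dvd [:- [:0, 1:]:]" by (simp add: fermat_form_explicit eval_nat_numeral)
    then have "degree h0 \<le> degree [:- [:0, 1::complex:]:]" by (intro dvd_imp_degree_le) auto
    then obtain h1 where h1: "h0 = [:h1:]" by (auto elim: degree_eq_zeroE)
    have "h0 dvd coeff (fermat_form $ 1) 1" using h[of 1] by (simp add: h0 const_poly_dvd_iff)
    then have "[:h1:] dvd - [:0, 0, 0, 1:]" by (simp add: fermat_form_explicit h1)
    then have "h1 dvd coeff (- [:0, 0, 0, 1:]) 3" unfolding const_poly_dvd_iff by blast
    then have "h1 dvd 1" by (simp add: eval_nat_numeral)
    then show ?thesis by (simp add: h0 h1 is_unit_const_poly_iff)
  qed
  moreover have "(\<Sum>i\<in>UNIV. coords $ i * fermat_form $ i) = 0"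
    by (simp add: sum_3 fermat_form_def Let_def algebra_simps power2_eq_square)
  moreover have "affine_form fermat_form = fermat_affine_form 3"
    by (simp add: affine_form_def fermat_affine_form_def fermat_form_explicit power3_eq_cube algebra_simps one_pCons)
  ultimately show ?thesis
    using hom by (simp add: fermat_foliation_def foliation_form_def no_common_factor_def)
qed

lemma linear_map_linear: "linear_map A $ i = linear_poly (A $ i)"
  by (rule ev_eqI) (simp add: linear_map_def ev_sum ev_linear sum_3 dotc_def)

lemma ev_pullback_linear:
  "ev (pullback (linear_map A) \<Omega> $ j) v = (\<Sum>i\<in>UNIV. ev (\<Omega> $ i) (A *v v) * A $ i $ j)"
proof -
  have "(\<chi> i. ev (linear_poly (A $ i)) v) = A *v v"
    by (simp add: vec_eq_iff ev_linear dotc_def matrix_vector_mult_def sum_3)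
  then show ?thesis
    by (simp add: pullback_def ev_sum ev_subst3 linear_map_linear pdiff_linear)
qed

theorem mainTheorem5:
  fixes \<Omega> :: "poly3 ^ 3"
  assumes "reduced_convex_foliation 3 \<Omega>"
  shows "\<exists>\<Omega>\<^sub>F. fermat_foliation 3 \<Omega>\<^sub>F \<and> linearly_conjugate \<Omega> \<Omega>\<^sub>F"
proof -
  obtain Z Z' where Z: "\<And>i. homogeneous 3 (Z $ i)" "\<Omega> = form_of_field Z"
      "product_of_invariant_lines \<Omega> (inflection_poly Z)"
    and Z': "\<And>i. homogeneous 3 (Z' $ i)" "\<Omega> = form_of_field Z'" "squarefree (inflection_poly Z')"
    using assms unfolding reduced_convex_foliation_def convex_foliation_def field_of_foliation_def by blast
  have "inflection_poly Z = inflection_poly Z'"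
  proof (rule ev_eqI)
    have "crossc (evv Z v) v = crossc (evv Z' v) v" for v
      using Z(2) Z'(2) ev_form_of_field by metis
    then show "ev (inflection_poly Z) v = ev (inflection_poly Z') v" for v
      unfolding ev_inflection[OF Z(1)] ev_inflection[OF Z'(1)]
      by (intro infl_eq_of_same_form cubic_field_polar) (simp add: Z_polar Z(1) Z'(1))
  qed
  then obtain L c where "nine_lines (polar_field Z) L c"
    using nine_lines_of_convex Z Z'(3) by metis
  then interpret nine_lines "polar_field Z" L c .
  obtain x y w where d: "det3 x y w \<noteq> 0"
    and inv: "\<And>f v. f \<in> {x, y, w, y - w, y + w, w - x, w + x, x - y, x + y} \<Longrightarrow> dotc f v = 0 \<Longrightarrow> dotc f (cubic_field.Z (polar_field Z) v) = 0"
    using B3_arrangement by blast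
  let ?Z = "cubic_field.Z (polar_field Z)"
  have \<Omega>: "evv \<Omega> v = crossc (?Z v) v" for v
    by (simp add: Z(2) ev_form_of_field Z_polar[OF Z(1)])
  obtain \<gamma> where \<gamma>:
    "\<And>v. dotc (evv \<Omega> v) (crossc y w) = \<gamma> * (dotc y v * dotc w v * ((dotc y v)\<^sup>2 - (dotc w v)\<^sup>2))"
    "\<And>v. dotc (evv \<Omega> v) (crossc w x) = \<gamma> * (dotc x v * dotc w v * ((dotc w v)\<^sup>2 - (dotc x v)\<^sup>2))"
    "\<And>v. dotc (evv \<Omega> v) (crossc x y) = \<gamma> * (dotc x v * dotc y v * ((dotc x v)\<^sup>2 - (dotc y v)\<^sup>2))"
    unfolding \<Omega> crossc_dotc_crossc using fermat_in_coordinates[OF d inv] by blast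
  have "\<gamma> \<noteq> 0"
  proof
    assume "\<gamma> = 0"
    obtain v where v: "\<And>i. i < 9 \<Longrightarrow> dotc (L i) v \<noteq> 0" using generic[of "{}"] by auto
    have "det3 x y w *s evv \<Omega> v = 0" unfolding cramer_dual by (simp add: \<gamma> \<open>\<gamma> = 0\<close>)
    then have "crossc v (?Z v) = 0" using d \<Omega> crossc_anti[of v] by simp
    then have "infl v = 0" by (simp add: infl_def det3_dotc dotc_linear)
    then show False using v c by (auto simp: infl_prod)
  qed
  \<comment> \<open>the columns of \<open>A\<close> are dual to \<open>x, y, w\<close> up to the factor \<open>det3 x y w\<close>, which is why its fourth power enters the scalar\<close>
  define A :: "complex ^ 3 ^ 3" where
    "A = (\<chi> i. vector [crossc y w $ i, crossc w x $ i, crossc x y $ i])"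
  define B :: "complex ^ 3 ^ 3" where "B = (\<chi> i. (1 / det3 x y w) *s vector [x, y, w] $ i)"
  have col: "A *v v = v $ 1 *s crossc y w + v $ 2 *s crossc w x + v $ 3 *s crossc x y" for v
    by (simp add: A_def matrix_vector_mult_def vec_eq_iff sum_3 algebra_simps)
  have coord: "dotc x (A *v v) = det3 x y w * v $ 1" "dotc y (A *v v) = det3 x y w * v $ 2"
    "dotc w (A *v v) = det3 x y w * v $ 3" for v
    unfolding col by (simp_all add: dotc_linear) (simp_all add: vec3_simps algebra_simps)
  have "B ** A = mat 1"
    using d by (simp add: B_def A_def matrix_matrix_mult_def mat_def vec_eq_iff forall_3 sum_3 divide_simps)
      (simp add: vec3_simps algebra_simps)
  then have "invertible A" using invertible_left_inverse by blast
  define k where "k = - \<gamma> * det3 x y w ^ 4"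
  have "pullback (linear_map A) \<Omega> $ j = const3 k * fermat_form $ j" for j
  proof (rule ev_eqI)
    fix v
    have "ev (pullback (linear_map A) \<Omega> $ j) v = dotc (evv \<Omega> (A *v v)) (\<chi> i. A $ i $ j)"
      by (simp add: ev_pullback_linear evv_def dotc_def sum_3)
    also have "\<dots> = ev (const3 k * fermat_form $ j) v"
    proof -
      have "(\<chi> i. A $ i $ 1) = crossc y w" "(\<chi> i. A $ i $ 2) = crossc w x" "(\<chi> i. A $ i $ 3) = crossc x y"
        by (simp_all add: A_def vec_eq_iff)
      then show ?thesis
        using exhaust_3[of j]
        by (elim disjE) (simp_all add: \<gamma> coord fermat_form_def Let_def k_def power_mult_distrib
            power2_eq_square eval_nat_numeral algebra_simps)
    qed
    finally show "ev (pullback (linear_map A) \<Omega> $ j) v = ev (const3 k * fermat_form $ j) v" .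
  qed
  moreover have "k \<noteq> 0" using \<open>\<gamma> \<noteq> 0\<close> d by (simp add: k_def)
  ultimately have "linearly_conjugate \<Omega> fermat_form"
    using \<open>invertible A\<close> unfolding linearly_conjugate_def by blast
  then show ?thesis using fermat_foliation_form by blast
qed

end
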